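(* For any positive constant $A$ there is a positive constant $B$ such that the following holds. For any $0<\mu\le1$ and any sufficiently large $n$ (depending on $A$, $B$ and $\mu$), $$\mathbf P\big(c(M_n^\mu)\ge n^B\big)\le n^{-A}.$$
   Context: For $0\le\mu\le1$, $\eta^\mu$ is a random variable equal to $0$ with probability $1-\mu$ and to $+1$, $-1$ with probability $\mu/2$ each. $M_n^\mu$ is the $n\times n$ random matrix whose entries are i.i.d. copies of $\eta^\mu$. For an $n\times n$ real matrix $M$, $\sigma_1(M):=\sup_{x\in\mathbb R^n,\|x\|=1}\|Mx\|$ (Euclidean norms). If $M$ is invertible its condition number is $c(M):=\sigma_1(M)\sigma_1(M^{-1})$; if $M$ is not invertible, $c(M):=\infty$. *)

theory Defs
  imports "HOL-Probability.Probability" "HOL-Probability.Product_PMF"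
    "Jordan_Normal_Form.Gauss_Jordan_Elimination"
begin

text \<open>
  The law of $\eta^\mu$: a Bernoulli coin decides whether the value is nonzero, and if so the sign
  is uniform. Meaningful for $0 \le \mu \le 1$ only; the probabilities are
  computed in \<open>pmf_eta\<close> below.
\<close>

definition eta_pmf :: "real \<Rightarrow> real pmf" where
  "eta_pmf \<mu> =
     bind_pmf (bernoulli_pmf \<mu>) (\<lambda>b. if b then pmf_of_set {1, -1} else return_pmf 0)"

lemma pmf_eta:
  assumes "0 \<le> \<mu>" "\<mu> \<le> 1"
  shows "pmf (eta_pmf \<mu>) 0 = 1 - \<mu>"
    and "pmf (eta_pmf \<mu>) 1 = \<mu> / 2"
    and "pmf (eta_pmf \<mu>) (-1) = \<mu> / 2"
  using assms by (simp_all add: eta_pmf_def pmf_bind pmf_of_set)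

text \<open>
  The law of $M_n^\mu$: \<open>Pi_pmf\<close> is the product measure, so the entries with index in
  $\{0,\dots,n-1\}^2$ are independent with law \<open>eta_pmf \<mu>\<close>. The value 0 that it assigns
  outside this index set is not used by \<open>mat n n\<close>.
\<close>

definition random_mat :: "nat \<Rightarrow> real \<Rightarrow> real mat pmf" where
  "random_mat n \<mu> = map_pmf (\<lambda>x. mat n n x) (Pi_pmf ({..<n} \<times> {..<n}) 0 (\<lambda>_. eta_pmf \<mu>))"

definition euclid_norm :: "real vec \<Rightarrow> real" where
  "euclid_norm x = sqrt (scalar_prod x x)"

lemma euclid_norm_altdef: "euclid_norm x = sqrt (\<Sum>i<dim_vec x. (vec_index x i)\<^sup>2)"
  by (simp add: euclid_norm_def scalar_prod_def power2_eq_square lessThan_atLeast0)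

text \<open>
  For a matrix without columns the supremum is over the empty set and has no meaning.
\<close>

definition sigma1 :: "real mat \<Rightarrow> real" where
  "sigma1 M = (SUP x\<in>{x \<in> carrier_vec (dim_col M). euclid_norm x = 1}. euclid_norm (M *\<^sub>v x))"

definition condition_number :: "real mat \<Rightarrow> ereal" where
  "condition_number M =
     (if invertible_mat M then ereal (sigma1 M * sigma1 (the (mat_inverse M))) else \<infinity>)"

text \<open>
  \<open>mat_inverse\<close> is computed by Gauss-Jordan elimination; on invertible matrices it succeeds and
  returns the two-sided inverse.
\<close>

lemma mat_inverse_invertible:
  fixes M :: "real mat"
  assumes M: "M \<in> carrier_mat n n" and inv: "invertible_mat M"
  shows "the (mat_inverse M) \<in> carrier_mat n n"
    and "M * the (mat_inverse M) = 1\<^sub>m n"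
    and "the (mat_inverse M) * M = 1\<^sub>m n"
proof -
  obtain B where B: "M * B = 1\<^sub>m (dim_row M)" "B * M = 1\<^sub>m (dim_row B)"
    using inv by (auto simp: invertible_mat_def inverts_mat_def)
  have "dim_col B = n" "dim_row B = n"
    using M arg_cong[OF B(1), of dim_col] arg_cong[OF B(2), of dim_col] by auto
  hence "M \<in> Units (ring_mat TYPE(real) n ())"
    using M B by (auto simp: Units_def ring_mat_def intro!: bexI[of _ B])
  then obtain C where "mat_inverse M = Some C"
    using mat_inverse(1)[OF M, where b = "()"] by (cases "mat_inverse M") auto
  with mat_inverse(2)[OF M this]
  show "the (mat_inverse M) \<in> carrier_mat n n"
    "M * the (mat_inverse M) = 1\<^sub>m n" "the (mat_inverse M) * M = 1\<^sub>m n" by auto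
qed

end

theory Submission
  imports Defs "HOL-Probability.Hoeffding" "Jordan_Normal_Form.Determinant"
    "HOL-Real_Asymp.Real_Asymp"
begin

text \<open>
  Write \<open>X\<close> for a random row. The entries of \<open>M\<close> are at most 1 in absolute value, so a huge condition
  number forces \<open>M\<close> to be singular or its inverse to have a huge entry. If that entry lies in
  column \<open>i\<close>, then row \<open>i\<close> of \<open>M\<close> nearly lies in the span of the other rows: it is
  nearly orthogonal to every unit vector that is normal to them
  (\<open>large_condition_number_imp_row_near_span\<close>). Let \<open>v\<close> be such a unit normal, chosen as a function
  of the other rows only. Row \<open>i\<close> is independent of \<open>v\<close>, so everything reduces to the small ball
  probability \<open>P(\<bar>X \<bullet> v\<bar> \<le> t)\<close> at a polynomially small scale \<open>t\<close>, for all \<open>v\<close> outside a set that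
  contains such a normal with negligible probability only.
  
  The small ball probability is governed by Diophantine properties of \<open>v\<close>, in the spirit of the
  least common denominator of Rudelson and Vershynin. The Fejer kernel with the
  frequencies \<open>\<pi> m\<close>, \<open>m < N\<close>, dominates the indicator of
  \<open>\<bar>X \<bullet> v\<bar> \<le> 1 / (3 N)\<close> up to a factor 4, and the expectation of
  \<open>cos (\<pi> k (X \<bullet> v))\<close> is at most \<open>exp (- (\<mu> / 2) d\<^sup>2)\<close>, where \<open>d\<close> is the distance of \<open>k v\<close> from
  the lattice of integer points. Hence the probability is \<open>O(\<kappa> / N)\<close>, up to a tiny error, as soon
  as no multiple \<open>k v\<close> with \<open>\<kappa> \<le> k < N\<close> is close to the lattice (\<open>small_ball\<close>).
  
  It remains to see that a normal \<open>v\<close> of \<open>n - 1\<close> rows is unlikely to have a multiple close to the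
  lattice. Let \<open>k \<ge> \<kappa>\<close> be the least integer such that \<open>k v\<close> is within \<open>L\<close> of a lattice point \<open>z\<close>. Then
  \<open>z\<close> determines \<open>v\<close> up to \<open>O(L / k)\<close>, and \<open>z\<close> has norm at most \<open>2 k\<close>. So a union bound over the
  possible \<open>z\<close>, with one representative \<open>v\<close> for each, suffices: since the operator norm
  of \<open>M\<close> is almost \<open>O(\<surd>n)\<close> (\<open>prob_norm_large_le\<close>), the rows are in mean square nearly orthogonal
  to the representative, and tensorization turns this into the \<open>(n - 1)\<close>-st power of a small ball
  probability (\<open>level_set_orthogonal\<close>). There are two regimes.
  
  \<^item> For large \<open>k\<close> there are at most \<open>O(1 + k / \<surd>n)\<^sup>n\<close> points \<open>z\<close>. The minimality of \<open>k\<close> makes the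
  small ball estimate available at a scale close to \<open>1 / k\<close>, so that each point contributes
  about \<open>(\<kappa> / k)\<^sup>n\<close>, and the product is small, because \<open>\<kappa>\<close> is much smaller than
  both \<open>k\<close> and \<open>\<surd>n\<close>.
  
  \<^item> For small \<open>k\<close> the point \<open>z\<close> has few nonzero coordinates, and there are only \<open>exp (o(n))\<close> of them.
  The trivial fact that \<open>X \<bullet> v\<close> is not concentrated near 0 (\<open>crude_small_ball\<close>) then
  yields an exponentially small bound.
  
  With \<open>q = n powr (1/40)\<close>, the choices are \<open>L = q\<close>, \<open>\<kappa> = q ^ 4\<close>, the operator norm bound \<open>q ^ 21\<close>
  (a little more than \<open>\<surd>n = q ^ 20\<close>), and \<open>q ^ 11\<close> as the border between the regimes.
  The exponents leave room for losing constants and small powers of \<open>q\<close> in every row,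
  which is why no estimate below has to be sharp.
\<close>

section \<open>Vectors and random rows\<close>

definition dot :: "nat \<Rightarrow> (nat \<Rightarrow> real) \<Rightarrow> (nat \<Rightarrow> real) \<Rightarrow> real" where
  "dot n x v = (\<Sum>j<n. x j * v j)"

definition sqnorm :: "nat \<Rightarrow> (nat \<Rightarrow> real) \<Rightarrow> real" where
  "sqnorm n v = (\<Sum>j<n. (v j)\<^sup>2)"

definition lattice_sqdist :: "nat \<Rightarrow> (nat \<Rightarrow> real) \<Rightarrow> real" where
  "lattice_sqdist n v = (\<Sum>j<n. (v j - of_int (round (v j)))\<^sup>2)"

lemma sqnorm_scale: "sqnorm n (\<lambda>j. c * v j) = c\<^sup>2 * sqnorm n v"
  by (simp add: sqnorm_def power_mult_distrib sum_distrib_left)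

lemma dot_scale: "dot n x (\<lambda>j. c * v j) = c * dot n x v"
  by (simp add: dot_def sum_distrib_left mult_ac)

lemma sqnorm_nonneg [simp]: "0 \<le> sqnorm n v"
  by (simp add: sqnorm_def sum_nonneg)

definition row_pmf :: "nat \<Rightarrow> real \<Rightarrow> (nat \<Rightarrow> real) pmf" where
  "row_pmf n \<mu> = Pi_pmf {..<n} 0 (\<lambda>_. eta_pmf \<mu>)"

definition rows_pmf :: "nat \<Rightarrow> real \<Rightarrow> (nat \<Rightarrow> nat \<Rightarrow> real) pmf" where
  "rows_pmf n \<mu> = Pi_pmf {..<n} (\<lambda>_. 0) (\<lambda>_. row_pmf n \<mu>)"

lemma set_eta_pmf: "set_pmf (eta_pmf \<mu>) \<subseteq> {0, 1, -1}"
  by (auto simp: eta_pmf_def set_bind_pmf split: if_splits)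

lemma finite_set_eta_pmf: "finite (set_pmf (eta_pmf \<mu>))"
  using set_eta_pmf by (rule finite_subset) auto

lemma expectation_eta_pmf:
  fixes f :: "real \<Rightarrow> real"
  assumes "0 \<le> \<mu>" "\<mu> \<le> 1"
  shows "measure_pmf.expectation (eta_pmf \<mu>) f = (1 - \<mu>) * f 0 + \<mu> / 2 * f 1 + \<mu> / 2 * f (-1)"
  using set_eta_pmf by (subst integral_measure_pmf[of "{0,1,-1}"]) (auto simp: pmf_eta assms)

lemma finite_set_Pi_pmf:
  assumes "finite A" "\<And>x. x \<in> A \<Longrightarrow> finite (set_pmf (p x))"
  shows "finite (set_pmf (Pi_pmf A d p))"
  using assms by (simp add: set_Pi_pmf finite_PiE_dflt)

lemma finite_set_row_pmf: "finite (set_pmf (row_pmf n \<mu>))"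
  unfolding row_pmf_def by (intro finite_set_Pi_pmf finite_set_eta_pmf) auto

lemma finite_set_rows_pmf: "finite (set_pmf (rows_pmf n \<mu>))"
  unfolding rows_pmf_def by (intro finite_set_Pi_pmf finite_set_row_pmf) auto

lemma abs_row_pmf_le_1:
  assumes "x \<in> set_pmf (row_pmf n \<mu>)"
  shows "\<bar>x j\<bar> \<le> 1"
proof -
  have "x \<in> PiE_dflt {..<n} 0 (\<lambda>_. set_pmf (eta_pmf \<mu>))"
    using assms by (simp add: row_pmf_def set_Pi_pmf)
  then show ?thesis using set_eta_pmf[of \<mu>]
    by (cases "j < n") (force simp: PiE_dflt_def)+
qed

lemma abs_rows_pmf_le_1:
  assumes "R \<in> set_pmf (rows_pmf n \<mu>)"
  shows "\<bar>R i j\<bar> \<le> 1"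
proof -
  have "R \<in> PiE_dflt {..<n} (\<lambda>_. 0) (\<lambda>_. set_pmf (row_pmf n \<mu>))"
    using assms by (simp add: rows_pmf_def set_Pi_pmf finite_set_row_pmf)
  then show ?thesis using abs_row_pmf_le_1
    by (cases "i < n") (force simp: PiE_dflt_def)+
qed

text \<open>
  Independence is used row by row, so the product over pairs of indices is regrouped as a
  product of rows, each of which is a product of entries.
\<close>

lemma random_mat_rows:
  "random_mat n \<mu> = map_pmf (\<lambda>R. mat n n (\<lambda>(i, j). R i j)) (rows_pmf n \<mu>)"
proof -
  have inj: "inj (case_prod :: (nat \<Rightarrow> nat \<Rightarrow> real) \<Rightarrow> _)"
    by (rule inj_onI) (metis curry_case_prod)
  have "Pi_pmf ({..<n} \<times> {..<n}) 0 (\<lambda>_. eta_pmf \<mu>) = map_pmf case_prod (rows_pmf n \<mu>)"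
  proof (rule pmf_eqI)
    fix y :: "nat \<times> nat \<Rightarrow> real"
    define R where "R = curry y"
    have y: "y = case_prod R" by (simp add: R_def)
    have "pmf (map_pmf case_prod (rows_pmf n \<mu>)) y = pmf (rows_pmf n \<mu>) R"
      unfolding y by (rule pmf_map_inj'[OF inj])
    also have "\<dots> = (if \<forall>i j. i \<notin> {..<n} \<or> j \<notin> {..<n} \<longrightarrow> R i j = 0
        then \<Prod>i<n. \<Prod>j<n. pmf (eta_pmf \<mu>) (R i j) else 0)"
    proof (cases "\<forall>i j. i \<notin> {..<n} \<or> j \<notin> {..<n} \<longrightarrow> R i j = 0")
      case True
      then show ?thesis
        by (auto simp: rows_pmf_def row_pmf_def pmf_Pi fun_eq_iff intro!: prod.cong)
    next
      case False
      show ?thesis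
      proof (cases "\<forall>i. i \<notin> {..<n} \<longrightarrow> R i = (\<lambda>_. 0)")
        case True
        obtain i j where ij: "i \<notin> {..<n} \<or> j \<notin> {..<n}" "R i j \<noteq> 0"
          using False by blast
        then have "i < n" using True by (metis lessThan_iff)
        with ij have "j \<ge> n" by simp
        with ij have "pmf (row_pmf n \<mu>) (R i) = 0"
          unfolding row_pmf_def by (intro pmf_Pi_outside) (auto intro!: exI[of _ j])
        with \<open>i < n\<close> have "(\<Prod>i<n. pmf (row_pmf n \<mu>) (R i)) = 0" by auto
        with False show ?thesis by (auto simp: rows_pmf_def pmf_Pi)
      next
        case nz: False
        then have "pmf (rows_pmf n \<mu>) R = 0"
          unfolding rows_pmf_def by (intro pmf_Pi_outside) auto
        with False show ?thesis by auto
      qed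
    qed
    also have "\<dots> = pmf (Pi_pmf ({..<n} \<times> {..<n}) 0 (\<lambda>_. eta_pmf \<mu>)) y"
      by (auto simp: pmf_Pi y prod.cartesian_product intro!: prod.cong)
    finally show "pmf (Pi_pmf ({..<n} \<times> {..<n}) 0 (\<lambda>_. eta_pmf \<mu>)) y
        = pmf (map_pmf case_prod (rows_pmf n \<mu>)) y" ..
  qed
  then show ?thesis
    by (simp add: random_mat_def map_pmf_comp o_def case_prod_unfold)
qed

section \<open>Characteristic functions of rows\<close>

text \<open>
  The entries are symmetric, so the sine part of each factor of the characteristic function
  has expectation 0, and the real identity for \<open>cos\<close> can be proved one coordinate at a time.
  The shift \<open>b\<close> is there for the induction.
\<close>

lemma expectation_cos_Pi_eta:
  assumes \<mu>: "0 \<le> \<mu>" "\<mu> \<le> 1" and "finite A"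
  shows "measure_pmf.expectation (Pi_pmf A 0 (\<lambda>_. eta_pmf \<mu>)) (\<lambda>x. cos (b + (\<Sum>j\<in>A. x j * w j)))
           = cos b * (\<Prod>j\<in>A. 1 - \<mu> + \<mu> * cos (w j))"
  using \<open>finite A\<close>
proof (induction A arbitrary: b rule: finite_induct)
  case empty
  then show ?case by simp
next
  case (insert a A)
  let ?P = "Pi_pmf A 0 (\<lambda>_. eta_pmf \<mu>)"
  let ?h = "\<lambda>x. cos (b + (\<Sum>j\<in>insert a A. x j * w j))"
  have upd: "?h (f(a := y)) = cos ((b + y * w a) + (\<Sum>j\<in>A. f j * w j))" for f y
  proof -
    have "(\<Sum>j\<in>A. (f(a := y)) j * w j) = (\<Sum>j\<in>A. f j * w j)"
      using insert by (intro sum.cong) auto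
    then show ?thesis using insert by (simp add: add.assoc)
  qed
  have "measure_pmf.expectation (Pi_pmf (insert a A) 0 (\<lambda>_. eta_pmf \<mu>)) ?h
      = measure_pmf.expectation (eta_pmf \<mu> \<bind> (\<lambda>y. map_pmf (\<lambda>f. f(a := y)) ?P)) ?h"
    using insert by (simp add: Pi_pmf_insert' map_pmf_def)
  also have "\<dots> = (\<Sum>y\<in>{0, 1, -1}. pmf (eta_pmf \<mu>) y *
      measure_pmf.expectation (map_pmf (\<lambda>f. f(a := y)) ?P) ?h)"
    using set_eta_pmf insert finite_set_eta_pmf
    by (subst pmf_expectation_bind[of "{0, 1, -1}"])
       (auto simp: intro!: finite_imageI finite_set_Pi_pmf)
  also have "\<dots> = (\<Sum>y\<in>{0, 1, -1}. pmf (eta_pmf \<mu>) y *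
      (cos (b + y * w a) * (\<Prod>j\<in>A. 1 - \<mu> + \<mu> * cos (w j))))"
    unfolding integral_map_pmf upd insert.IH ..
  also have "\<dots> = cos b * ((1 - \<mu> + \<mu> * cos (w a)) * (\<Prod>j\<in>A. 1 - \<mu> + \<mu> * cos (w j)))"
    using \<mu> by (simp add: pmf_eta cos_add algebra_simps)
  finally show ?case using insert by simp
qed

text \<open>
  For \<open>\<mu> = 1\<close> the factor is \<open>cos w\<close>, whose absolute value returns to 1 at every multiple of
  \<open>\<pi>\<close>, not only of \<open>2 \<pi>\<close>. A bound through \<open>sin w\<close>, which has exactly these zeros, is therefore the right
  one for all \<open>\<mu>\<close> at once: it combines \<open>(sin w)\<^sup>2 \<le> 2 (1 - cos w)\<close> and \<open>(sin w)\<^sup>2 \<le> 2 (1 + cos w)\<close>.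
\<close>

lemma abs_eta_charfun_le:
  fixes \<mu> w :: real
  assumes "0 \<le> \<mu>" "\<mu> \<le> 1"
  shows "\<bar>1 - \<mu> + \<mu> * cos w\<bar> \<le> exp (- (\<mu> / 2) * (sin w)\<^sup>2)"
proof -
  have "(sin w)\<^sup>2 = (1 - cos w) * (1 + cos w)"
    using sin_cos_squared_add[of w] by (simp add: power2_eq_square algebra_simps)
  moreover have "(1 - cos w) * (1 + cos w) \<le> (1 - cos w) * 2"
    by (intro mult_left_mono) auto
  moreover have "(1 - cos w) * (1 + cos w) \<le> 2 * (1 + cos w)"
    by (intro mult_right_mono) (use cos_ge_minus_one[of w] in linarith)+
  ultimately have "(sin w)\<^sup>2 \<le> 2 * (1 - cos w)" "(sin w)\<^sup>2 \<le> 2 * (1 + cos w)" by linarith+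
  then have "\<mu> * (sin w)\<^sup>2 \<le> \<mu> * (2 * (1 - cos w))" "\<mu> * (sin w)\<^sup>2 \<le> \<mu> * (2 * (1 + cos w))"
    using assms by (intro mult_left_mono; simp)+
  then have "\<bar>1 - \<mu> + \<mu> * cos w\<bar> \<le> 1 + (- (\<mu> / 2) * (sin w)\<^sup>2)"
    using assms by (auto simp: abs_le_iff algebra_simps)
  also have "\<dots> \<le> exp (- (\<mu> / 2) * (sin w)\<^sup>2)" by (rule exp_ge_add_one_self)
  finally show ?thesis .
qed

lemma expectation_cos_dot_le:
  assumes \<mu>: "0 \<le> \<mu>" "\<mu> \<le> 1"
  shows "measure_pmf.expectation (row_pmf n \<mu>) (\<lambda>x. cos (t * dot n x v))
    \<le> exp (- (\<mu> / 2) * (\<Sum>j<n. (sin (t * v j))\<^sup>2))"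
proof -
  have "measure_pmf.expectation (row_pmf n \<mu>) (\<lambda>x. cos (t * dot n x v))
      = (\<Prod>j<n. 1 - \<mu> + \<mu> * cos (t * v j))"
    using expectation_cos_Pi_eta[OF \<mu>, of "{..<n}" 0 "\<lambda>j. t * v j"]
    by (simp add: row_pmf_def dot_def sum_distrib_left mult_ac)
  also have "\<dots> \<le> \<bar>\<Prod>j<n. 1 - \<mu> + \<mu> * cos (t * v j)\<bar>" by simp
  also have "\<dots> = (\<Prod>j<n. \<bar>1 - \<mu> + \<mu> * cos (t * v j)\<bar>)" by (rule abs_prod)
  also have "\<dots> \<le> (\<Prod>j<n. exp (- (\<mu> / 2) * (sin (t * v j))\<^sup>2))"
    using \<mu> by (intro prod_mono conjI abs_eta_charfun_le) auto
  also have "\<dots> = exp (- (\<mu> / 2) * (\<Sum>j<n. (sin (t * v j))\<^sup>2))"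
    by (simp add: exp_sum sum_distrib_left)
  finally show ?thesis .
qed

text \<open>
  Monotonicity of \<open>sin x - x / 2\<close> works up to \<open>\<pi> / 3\<close>, where the derivative changes its sign;
  beyond that point \<open>sin\<close> is at least \<open>\<surd>3 / 2\<close>, which exceeds \<open>\<pi> / 4\<close>.
\<close>

lemma half_le_sin:
  assumes "0 \<le> y" "y \<le> pi / 2"
  shows "y / 2 \<le> sin (y::real)"
proof (cases "y \<le> pi / 3")
  case True
  have "(\<lambda>x. sin x - x / 2) 0 \<le> (\<lambda>x. sin x - x / 2) y"
  proof (rule DERIV_nonneg_imp_nondecreasing[OF assms(1)])
    fix x assume x: "0 \<le> x" "x \<le> y"
    have "cos (pi / 3) \<le> cos x" using x True by (intro cos_monotone_0_pi_le) auto
    then show "\<exists>d. ((\<lambda>x. sin x - x / 2) has_real_derivative d) (at x) \<and> 0 \<le> d"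
      by (intro exI[of _ "cos x - 1 / 2"]) (auto intro!: derivative_eq_intros simp: cos_60)
  qed
  then show ?thesis by simp
next
  case False
  have "sqrt 3 / 2 = sin (pi / 3)" by (simp add: sin_60)
  also have "\<dots> \<le> sin y" using False assms by (intro sin_monotone_2pi_le) auto
  finally have "sqrt 3 / 2 \<le> sin y" .
  moreover have "1.7 \<le> sqrt 3" by (rule real_le_rsqrt) (simp add: power2_eq_square)
  moreover have "pi \<le> 3.4" using pi_approx by simp
  ultimately show ?thesis using assms by simp
qed

text \<open>
  This links the characteristic function at the frequency \<open>\<pi> k\<close> to the distance of \<open>k v\<close> from
  the integer lattice.
\<close>

lemma nint_dist_le_sin_pi: "(x - of_int (round x))\<^sup>2 \<le> (sin (pi * x))\<^sup>2"
proof -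
  define d where "d = x - of_int (round x)"
  have d: "\<bar>d\<bar> \<le> 1/2" using of_int_round_abs_le[of x] by (simp add: d_def abs_minus_commute)
  have "sin (pi * x) = sin (pi * d + of_int (round x) * pi)" by (simp add: d_def algebra_simps)
  also have "\<dots> = sin (pi * d) * cos (of_int (round x) * pi)"
    by (simp add: sin_add sin_zero_iff_int2)
  finally have "(sin (pi * x))\<^sup>2 = (sin (pi * d))\<^sup>2 * (cos (of_int (round x) * pi))\<^sup>2"
    by (simp add: power_mult_distrib)
  also have "(cos (of_int (round x) * pi))\<^sup>2 = 1"
    by (simp add: cos_squared_eq sin_zero_iff_int2)
  also have "(sin (pi * d))\<^sup>2 * 1 = (sin (pi * \<bar>d\<bar>))\<^sup>2"
    by (cases "d \<ge> 0") auto
  finally have eq: "(sin (pi * x))\<^sup>2 = (sin (pi * \<bar>d\<bar>))\<^sup>2" .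
  have "\<bar>d\<bar> * 2 \<le> \<bar>d\<bar> * pi" by (intro mult_left_mono pi_ge_two) auto
  then have "\<bar>d\<bar> \<le> (pi * \<bar>d\<bar>) / 2" by (simp add: mult.commute)
  also have "\<dots> \<le> sin (pi * \<bar>d\<bar>)" using d by (intro half_le_sin) auto
  finally have "\<bar>d\<bar>\<^sup>2 \<le> (sin (pi * \<bar>d\<bar>))\<^sup>2" by (intro power_mono) auto
  then show ?thesis by (simp add: eq d_def)
qed

section \<open>Small ball estimates\<close>

lemma integrable_row_pmf [simp]:
  "integrable (measure_pmf (row_pmf n \<mu>)) (f :: _ \<Rightarrow> real)"
  by (rule integrable_measure_pmf_finite[OF finite_set_row_pmf])

lemma one_minus_half_square_le_cos: "1 - x\<^sup>2 / 2 \<le> cos (x :: real)"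
proof -
  have "\<bar>sin (x / 2)\<bar>\<^sup>2 \<le> \<bar>x / 2\<bar>\<^sup>2" by (intro power_mono abs_sin_x_le_abs_x) auto
  then show ?thesis using cos_double_sin[of "x / 2"] by (simp add: power_divide)
qed

lemma prob_le_expectation:
  fixes f :: "'a \<Rightarrow> real"
  assumes "finite (set_pmf p)" "\<And>x. x \<in> set_pmf p \<Longrightarrow> 0 \<le> f x"
    and "\<And>x. x \<in> set_pmf p \<Longrightarrow> x \<in> S \<Longrightarrow> c \<le> f x"
  shows "c * measure_pmf.prob p S \<le> measure_pmf.expectation p f"
proof -
  have "c * measure_pmf.prob p S = measure_pmf.expectation p (\<lambda>x. c * indicator S x)"
    by simp
  also have "\<dots> \<le> measure_pmf.expectation p f"
    using assms by (intro integral_mono_AE integrable_measure_pmf_finite)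
      (auto simp: AE_measure_pmf_iff indicator_def)
  finally show ?thesis .
qed

text \<open>
  This is the squared absolute value of the sum of \<open>exp (i a m)\<close>, written without complex
  numbers.
\<close>

lemma norm_sum_cis_sq:
  "(\<Sum>m<N. cos (a m))\<^sup>2 + (\<Sum>m<N. sin (a m))\<^sup>2
     = (\<Sum>m<N. \<Sum>m'<N. cos (a m - a m' :: real))"
  by (simp add: power2_eq_square sum_product cos_diff sum.distrib)

text \<open>
  The kernel \<open>F\<close> is the squared absolute value of the sum of the characters
  \<open>exp (i \<pi> m (X \<bullet> v))\<close>, \<open>m < N\<close>. If \<open>\<bar>X \<bullet> v\<bar> \<le> 1 / (3 N)\<close>, then all angles are at
  most \<open>\<pi> / 3\<close>, the sum has real part at least \<open>N / 2\<close>, and \<open>F \<ge> N\<^sup>2 / 4\<close>. The expectation of \<open>F\<close> is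
  a sum over pairs \<open>(m, m')\<close> of terms that depend on \<open>k = \<bar>m - m'\<bar>\<close> only: the \<open>O(\<kappa> N)\<close> pairs with
  \<open>k < \<kappa>\<close> contribute at most 1 each, and the others are small by the assumption \<open>far\<close>.
\<close>

lemma small_ball:
  fixes v :: "nat \<Rightarrow> real" and \<kappa> N :: nat
  assumes \<mu>: "0 \<le> \<mu>" "\<mu> \<le> 1" and N: "N > 0"
    and far: "\<And>k. \<kappa> \<le> k \<Longrightarrow> k < N \<Longrightarrow> L2 \<le> lattice_sqdist n (\<lambda>j. real k * v j)"
  shows "measure_pmf.prob (row_pmf n \<mu>) {x. \<bar>dot n x v\<bar> \<le> 1 / (3 * real N)}
    \<le> 4 * ((2 * real \<kappa> + 1) / real N + exp (- (\<mu> / 2) * L2))"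
proof -
  let ?E = "measure_pmf.expectation (row_pmf n \<mu>)"
  let ?S = "{x. \<bar>dot n x v\<bar> \<le> 1 / (3 * real N)}"
  define a where "a = (\<lambda>x m. pi * real m * dot n x v)"
  define F where "F = (\<lambda>x. (\<Sum>m<N. cos (a x m))\<^sup>2 + (\<Sum>m<N. sin (a x m))\<^sup>2)"
  define ex where "ex = exp (- (\<mu> / 2) * L2)"
  have F_ge: "(real N / 2)\<^sup>2 \<le> F x" if "x \<in> ?S" for x
  proof -
    have "1 / 2 \<le> cos (a x m)" if m: "m < N" for m
    proof -
      have "\<bar>a x m\<bar> = pi * real m * \<bar>dot n x v\<bar>" by (simp add: a_def abs_mult)
      also have "\<dots> \<le> pi * real N * (1 / (3 * real N))"
        using m \<open>x \<in> ?S\<close> by (intro mult_mono) auto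
      also have "\<dots> = pi / 3" using N by simp
      finally have "cos (pi / 3) \<le> cos \<bar>a x m\<bar>" by (intro cos_monotone_0_pi_le) auto
      then show ?thesis by (simp add: cos_60)
    qed
    then have "(\<Sum>m<N. 1 / 2) \<le> (\<Sum>m<N. cos (a x m))" by (intro sum_mono) auto
    then have "(real N / 2)\<^sup>2 \<le> (\<Sum>m<N. cos (a x m))\<^sup>2" by (intro power_mono) auto
    then show ?thesis by (simp add: F_def add_increasing2)
  qed
  have pair: "?E (\<lambda>x. cos (a x m - a x m')) \<le> (if m < m' + \<kappa> \<and> m' < m + \<kappa> then 1 else 0) + ex"
    if m: "m < N" "m' < N" for m m'
  proof (cases "m < m' + \<kappa> \<and> m' < m + \<kappa>")
    case True
    have "?E (\<lambda>x. cos (a x m - a x m')) \<le> ?E (\<lambda>_. 1)" by (intro integral_mono) auto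
    then show ?thesis using True by (simp add: ex_def add_increasing2)
  next
    case False
    define k where "k = (if m \<le> m' then m' - m else m - m')"
    have k: "\<kappa> \<le> k" "k < N" using False m by (auto simp: k_def)
    have "cos (a x m - a x m') = cos (pi * real k * dot n x v)" for x
    proof -
      have "a x m - a x m' = pi * real k * dot n x v \<or> a x m - a x m' = - (pi * real k * dot n x v)"
        by (auto simp: a_def k_def of_nat_diff algebra_simps)
      then show ?thesis by (metis cos_minus)
    qed
    then have "?E (\<lambda>x. cos (a x m - a x m'))
        \<le> exp (- (\<mu> / 2) * (\<Sum>j<n. (sin (pi * real k * v j))\<^sup>2))"
      using expectation_cos_dot_le[OF \<mu>, of n "pi * real k" v] by simp
    also have "\<dots> \<le> exp (- (\<mu> / 2) * lattice_sqdist n (\<lambda>j. real k * v j))"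
      unfolding lattice_sqdist_def exp_le_cancel_iff
      using \<mu> nint_dist_le_sin_pi[of "real k * v _"]
      by (intro mult_left_mono_neg sum_mono) (auto simp: mult.assoc)
    also have "\<dots> \<le> ex" unfolding ex_def exp_le_cancel_iff
      using \<mu> far[OF k] by (intro mult_left_mono_neg) auto
    finally show ?thesis using False by simp
  qed
  have "(real N / 2)\<^sup>2 * measure_pmf.prob (row_pmf n \<mu>) ?S \<le> ?E F"
    using F_ge by (intro prob_le_expectation finite_set_row_pmf) (auto simp: F_def)
  also have "?E F = (\<Sum>m<N. \<Sum>m'<N. ?E (\<lambda>x. cos (a x m - a x m')))"
    unfolding F_def norm_sum_cis_sq by (simp add: Bochner_Integration.integral_sum)
  also have "\<dots> \<le> (\<Sum>m<N. \<Sum>m'<N. (if m < m' + \<kappa> \<and> m' < m + \<kappa> then 1 else 0) + ex)"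
    by (intro sum_mono pair) auto
  also have "\<dots> \<le> (\<Sum>m<N. (2 * real \<kappa> + 1) + real N * ex)"
  proof (intro sum_mono)
    fix m
    have "card ({..<N} \<inter> {m'. m < m' + \<kappa> \<and> m' < m + \<kappa>}) \<le> card {m - \<kappa>..m + \<kappa>}"
      by (intro card_mono) auto
    also have "\<dots> \<le> 2 * \<kappa> + 1" by auto
    finally have "real (card ({..<N} \<inter> {m'. m < m' + \<kappa> \<and> m' < m + \<kappa>})) \<le> 2 * real \<kappa> + 1"
      by linarith
    then show "(\<Sum>m'<N. (if m < m' + \<kappa> \<and> m' < m + \<kappa> then 1 else 0) + ex) \<le> (2 * real \<kappa> + 1) + real N * ex"
      by (simp add: sum.distrib sum.If_cases)
  qed
  also have "\<dots> = (real N)\<^sup>2 * ((2 * real \<kappa> + 1) / real N + ex)"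
    using N by (simp add: power2_eq_square field_simps)
  finally have "(real N)\<^sup>2 * measure_pmf.prob (row_pmf n \<mu>) ?S
      \<le> (real N)\<^sup>2 * (4 * ((2 * real \<kappa> + 1) / real N + ex))"
    by (simp add: power_divide algebra_simps)
  then have "measure_pmf.prob (row_pmf n \<mu>) ?S \<le> 4 * ((2 * real \<kappa> + 1) / real N + ex)"
    by (rule mult_left_le_imp_le) (use N in simp)
  then show ?thesis unfolding ex_def .
qed

text \<open>
  A unit vector gives \<open>X \<bullet> v\<close> a characteristic function bounded away from 1 at the frequency 1, and this
  rules out that \<open>X \<bullet> v\<close> is near 0 with probability close to 1. The constants depend on \<open>\<mu>\<close>
  but neither on \<open>n\<close> nor on \<open>v\<close>.
\<close>

lemma crude_small_ball:
  assumes \<mu>: "0 < \<mu>" "\<mu> \<le> 1"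
  obtains c p :: real where "0 < c" "p < 1" "0 \<le> p"
    "\<And>n v. sqnorm n v = 1 \<Longrightarrow> measure_pmf.prob (row_pmf n \<mu>) {x. \<bar>dot n x v\<bar> \<le> c} \<le> p"
proof -
  \<comment> \<open>\<open>r\<close> bounds the expectation of \<open>cos (X \<bullet> v)\<close>; \<open>c\<close> is so small that \<open>1 - c\<^sup>2 / 2 > r\<close>\<close>
  define r where "r = exp (- (\<mu> / 8))"
  have r: "0 < r" "r < 1" using \<mu> by (auto simp: r_def)
  define c where "c = sqrt ((1 - r) / 2)"
  have c2: "c\<^sup>2 = (1 - r) / 2" using r by (simp add: c_def)
  have c: "0 < c" "c < 1" using r by (auto simp: c_def)
  have c22: "c\<^sup>2 < 1" using c2 r by simp
  define p where "p = (1 + r) / (2 - c\<^sup>2 / 2)"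
  have p: "p < 1" "0 \<le> p" using r c2 c22 unfolding p_def
    by (auto simp: divide_less_eq_1_pos intro!: divide_nonneg_nonneg)
  have main: "measure_pmf.prob (row_pmf n \<mu>) {x. \<bar>dot n x v\<bar> \<le> c} \<le> p" if v: "sqnorm n v = 1" for n v
  proof -
    have "(\<Sum>j<n. (v j / 2)\<^sup>2) \<le> (\<Sum>j<n. (sin (v j))\<^sup>2)"
    proof (intro sum_mono)
      fix j assume j: "j \<in> {..<n}"
      have "(v j)\<^sup>2 \<le> 1" using v member_le_sum[of j "{..<n}" "\<lambda>j. (v j)\<^sup>2"] j
        by (simp add: sqnorm_def)
      then have "\<bar>v j\<bar> \<le> 1" by (simp add: abs_square_le_1)
      then have "\<bar>v j\<bar> / 2 \<le> sin \<bar>v j\<bar>" using pi_ge_two by (intro half_le_sin) auto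
      then have "(\<bar>v j\<bar> / 2)\<^sup>2 \<le> (sin \<bar>v j\<bar>)\<^sup>2" by (intro power_mono) auto
      moreover have "(sin \<bar>v j\<bar>)\<^sup>2 = (sin (v j))\<^sup>2" by (cases "v j \<ge> 0") auto
      ultimately show "(v j / 2)\<^sup>2 \<le> (sin (v j))\<^sup>2" by (simp add: power_divide)
    qed
    then have quarter: "1 / 4 \<le> (\<Sum>j<n. (sin (v j))\<^sup>2)"
      using v by (simp add: sqnorm_def power_divide sum_divide_distrib[symmetric])
    have "measure_pmf.expectation (row_pmf n \<mu>) (\<lambda>x. cos (dot n x v))
        \<le> exp (- (\<mu> / 2) * (\<Sum>j<n. (sin (v j))\<^sup>2))"
      using expectation_cos_dot_le[of \<mu> n 1 v] \<mu> by simp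
    also have "\<dots> \<le> r"
    proof -
      have "\<mu> / 2 * (1 / 4) \<le> \<mu> / 2 * (\<Sum>j<n. (sin (v j))\<^sup>2)"
        using \<mu> quarter by (intro mult_left_mono) auto
      then show ?thesis by (simp add: r_def)
    qed
    finally have E: "measure_pmf.expectation (row_pmf n \<mu>) (\<lambda>x. cos (dot n x v)) \<le> r" .
    have "(2 - c\<^sup>2 / 2) * measure_pmf.prob (row_pmf n \<mu>) {x. \<bar>dot n x v\<bar> \<le> c}
        \<le> measure_pmf.expectation (row_pmf n \<mu>) (\<lambda>x. 1 + cos (dot n x v))"
    proof (intro prob_le_expectation finite_set_row_pmf)
      fix x assume "x \<in> {x. \<bar>dot n x v\<bar> \<le> c}"
      then have "(dot n x v)\<^sup>2 \<le> c\<^sup>2" using c by (intro abs_le_square_iff[THEN iffD1]) auto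
      moreover have "1 - (dot n x v)\<^sup>2 / 2 \<le> cos (dot n x v)" by (rule one_minus_half_square_le_cos)
      ultimately show "2 - c\<^sup>2 / 2 \<le> 1 + cos (dot n x v)" by simp
    next
      fix x show "0 \<le> 1 + cos (dot n x v)" using cos_ge_minus_one[of "dot n x v"] by linarith
    qed
    also have "\<dots> \<le> 1 + r" using E by simp
    finally show ?thesis using c22 by (simp add: p_def pos_le_divide_eq mult.commute)
  qed
  show ?thesis by (rule that[OF c(1) p main])
qed

text \<open>
  Tensorization: by Markov's inequality for \<open>exp (- (\<Sum>i\<in>J. (X\<^sub>i \<bullet> v)\<^sup>2) / b\<^sup>2)\<close>, whose expectation
  is a product over the independent rows. Each factor is at most \<open>p + exp (- \<rho>\<^sup>2 / b\<^sup>2)\<close>, by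
  distinguishing whether \<open>\<bar>X\<^sub>i \<bullet> v\<bar> \<le> \<rho>\<close>. The free parameter \<open>b\<close> balances the two exponentials.
\<close>

lemma prob_rows_small_le:
  assumes p: "measure_pmf.prob (row_pmf n \<mu>) {x. \<bar>dot n x v\<bar> \<le> \<rho>} \<le> p"
    and J: "J \<subseteq> {..<n}" and b: "b > 0" and \<rho>: "0 \<le> \<rho>"
  shows "measure_pmf.prob (rows_pmf n \<mu>) {R. (\<Sum>i\<in>J. (dot n (R i) v)\<^sup>2) \<le> a2}
    \<le> exp (a2 / b\<^sup>2) * (p + exp (- (\<rho>\<^sup>2 / b\<^sup>2))) ^ card J"
proof -
  define g where "g = (\<lambda>x. exp (- ((dot n x v)\<^sup>2 / b\<^sup>2)))"
  define f where "f = (\<lambda>i x. if i \<in> J then g x else 1)"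
  let ?E = "measure_pmf.expectation (rows_pmf n \<mu>)"
  have prod_f: "(\<Prod>i<n. f i (R i)) = exp (- (\<Sum>i\<in>J. (dot n (R i) v)\<^sup>2) / b\<^sup>2)" for R
  proof -
    have "(\<Prod>i<n. f i (R i)) = (\<Prod>i\<in>J. g (R i))"
      using J by (simp add: f_def prod.If_cases Int_absorb1)
    also have "\<dots> = exp (\<Sum>i\<in>J. - ((dot n (R i) v)\<^sup>2 / b\<^sup>2))"
      using J by (simp add: g_def exp_sum finite_subset)
    finally show ?thesis by (simp add: sum_negf sum_divide_distrib)
  qed
  have g: "measure_pmf.expectation (row_pmf n \<mu>) g \<le> p + exp (- (\<rho>\<^sup>2 / b\<^sup>2))"
  proof -
    have "measure_pmf.expectation (row_pmf n \<mu>) g \<le> measure_pmf.expectation (row_pmf n \<mu>)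
        (\<lambda>x. indicator {x. \<bar>dot n x v\<bar> \<le> \<rho>} x + exp (- (\<rho>\<^sup>2 / b\<^sup>2)))"
    proof (intro integral_mono integrable_row_pmf)
      fix x
      show "g x \<le> indicator {x. \<bar>dot n x v\<bar> \<le> \<rho>} x + exp (- (\<rho>\<^sup>2 / b\<^sup>2))"
      proof (cases "\<bar>dot n x v\<bar> \<le> \<rho>")
        case False
        then have "\<rho>\<^sup>2 \<le> (dot n x v)\<^sup>2" using \<rho> by (intro abs_le_square_iff[THEN iffD1]) auto
        then show ?thesis using False by (simp add: g_def divide_right_mono)
      qed (simp add: g_def add_increasing2)
    qed
    also have "\<dots> = measure_pmf.prob (row_pmf n \<mu>) {x. \<bar>dot n x v\<bar> \<le> \<rho>} + exp (- (\<rho>\<^sup>2 / b\<^sup>2))"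
      by simp
    finally show ?thesis using p by simp
  qed
  have "exp (- a2 / b\<^sup>2) * measure_pmf.prob (rows_pmf n \<mu>) {R. (\<Sum>i\<in>J. (dot n (R i) v)\<^sup>2) \<le> a2}
      \<le> ?E (\<lambda>R. \<Prod>i<n. f i (R i))"
    by (intro prob_le_expectation finite_set_rows_pmf) (auto simp: prod_f divide_right_mono)
  also have "\<dots> = (\<Prod>i<n. measure_pmf.expectation (row_pmf n \<mu>) (f i))"
    unfolding rows_pmf_def
    by (intro expectation_prod_Pi_pmf) (auto simp: f_def g_def)
  also have "\<dots> = (\<Prod>i\<in>J. measure_pmf.expectation (row_pmf n \<mu>) g)"
  proof -
    have "measure_pmf.expectation (row_pmf n \<mu>) (f i)
        = (if i \<in> J then measure_pmf.expectation (row_pmf n \<mu>) g else 1)" for i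
      by (simp add: f_def)
    then show ?thesis using J by (simp add: prod.If_cases Int_absorb1)
  qed
  also have "\<dots> \<le> (p + exp (- (\<rho>\<^sup>2 / b\<^sup>2))) ^ card J"
    using g by (auto intro!: power_mono integral_nonneg simp: g_def)
  finally show ?thesis by (simp add: exp_minus field_simps)
qed

section \<open>Counting lattice points\<close>

text \<open>
  Since \<open>s l\<^sup>2 \<ge> 2 (\<surd>s) \<bar>l\<bar> - 1\<close>, the tails are dominated by geometric series.
\<close>

lemma sum_exp_neg_square_le:
  fixes s :: real
  assumes s: "s > 0"
  shows "(\<Sum>l\<in>{-M..M}. exp (- s * (real_of_int l)\<^sup>2)) \<le> 1 + 3 / sqrt s"
proof (cases "M \<ge> 0")
  case False
  then show ?thesis using s by simp
next
  case True
  define m where "m = nat M"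
  have M: "M = int m" using True by (simp add: m_def)
  define f where "f = (\<lambda>l::int. exp (- s * (real_of_int l)\<^sup>2))"
  define r where "r = exp (- 2 * sqrt s)"
  have r: "0 < r" "r < 1" using s by (auto simp: r_def)
  have f_le: "f (int k) \<le> 3 * r ^ k" for k
  proof -
    \<comment> \<open>\<open>2 (\<surd>s) k \<le> s k\<^sup>2 + 1\<close>, and \<open>exp 1 \<le> 3\<close>\<close>
    have "0 \<le> (sqrt s * real k - 1)\<^sup>2" by simp
    then have "- s * (real k)\<^sup>2 \<le> 1 + real k * (- 2 * sqrt s)"
      using s by (simp add: power2_diff power_mult_distrib mult_ac)
    then have "f (int k) \<le> exp 1 * r ^ k"
      by (simp add: f_def r_def exp_of_nat_mult[symmetric] exp_add[symmetric])
    also have "\<dots> \<le> 3 * r ^ k" using r exp_le by (intro mult_right_mono) auto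
    finally show ?thesis .
  qed
  have split: "(\<Sum>l\<in>{-int m..int m}. f l) = f 0 + 2 * (\<Sum>k\<in>{1..m}. f (int k))" for m
  proof (induction m)
    case (Suc m)
    have "{-int (Suc m)..int (Suc m)} = insert (- int (Suc m)) (insert (int (Suc m)) {-int m..int m})"
      by auto
    moreover have "f (- int (Suc m)) = f (int (Suc m))" unfolding f_def of_int_minus power2_minus ..
    ultimately show ?case using Suc by (simp del: of_nat_Suc)
  qed simp
  have geo: "(1 - r) * (\<Sum>k\<in>{1..m}. r ^ k) \<le> r" for m
  proof -
    have "(1 - r) * (\<Sum>k\<in>{1..m}. r ^ k) = r - r ^ Suc m"
    proof (induction m)
      case (Suc m)
      have "(1 - r) * (\<Sum>k\<in>{1..Suc m}. r ^ k)
          = (1 - r) * (\<Sum>k\<in>{1..m}. r ^ k) + (1 - r) * r ^ Suc m"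
        by (simp add: distrib_left)
      then show ?case unfolding Suc by (simp add: left_diff_distrib)
    qed simp
    then show ?thesis using r by simp
  qed
  have "2 * sqrt s * r \<le> 1 - r"
  proof -
    have "1 + 2 * sqrt s \<le> 1 / r"
      using exp_ge_add_one_self[of "2 * sqrt s"] by (simp add: r_def exp_minus field_simps)
    then have "(1 + 2 * sqrt s) * r \<le> 1" using r by (simp add: field_simps)
    then show ?thesis by (simp add: algebra_simps)
  qed
  then have "2 * sqrt s * r * (\<Sum>k\<in>{1..m}. r ^ k) \<le> (1 - r) * (\<Sum>k\<in>{1..m}. r ^ k)"
    using r by (intro mult_right_mono sum_nonneg) auto
  also have "\<dots> \<le> r" by (rule geo)
  finally have "r * (2 * sqrt s * (\<Sum>k\<in>{1..m}. r ^ k)) \<le> r * 1" by (simp add: mult_ac)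
  then have "2 * sqrt s * (\<Sum>k\<in>{1..m}. r ^ k) \<le> 1"
    by (rule mult_left_le_imp_le) (use r in simp)
  then have "2 * (\<Sum>k\<in>{1..m}. 3 * r ^ k) \<le> 3 / sqrt s"
    using s by (simp add: sum_distrib_left[symmetric] pos_le_divide_eq mult_ac)
  moreover have "(\<Sum>k\<in>{1..m}. f (int k)) \<le> (\<Sum>k\<in>{1..m}. 3 * r ^ k)"
    by (intro sum_mono f_le)
  ultimately show ?thesis unfolding M f_def[symmetric] split by (simp add: f_def)
qed

text \<open>
  A point of the ball of radius \<open>\<surd>T\<close> has weight \<open>exp (- s \<bar>z\<bar>\<^sup>2) \<ge> exp (- s T)\<close>, and the weights of all
  integer points sum up to the \<open>n\<close>-th power of a one-dimensional sum. The choice \<open>s = n / T\<close> gives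
  \<open>O(1 + \<surd>(T / n))\<^sup>n\<close>; for \<open>T\<close> much smaller than \<open>n\<close>, a larger \<open>s\<close> gives \<open>exp (o(n))\<close>, because most
  coordinates of \<open>z\<close> vanish.
\<close>

lemma card_lattice_points_le:
  fixes s T :: real
  assumes s: "s > 0"
    and Z: "Z \<subseteq> {z \<in> extensional {..<n}. (\<Sum>j<n. (real_of_int (z j))\<^sup>2) \<le> T}"
  shows "finite Z" and "real (card Z) \<le> exp (s * T) * (1 + 3 / sqrt s) ^ n"
proof -
  define M where "M = \<lceil>T\<rceil>"
  define B where "B = PiE {..<n} (\<lambda>_. {-M..M})"
  have fB: "finite B" unfolding B_def by (intro finite_PiE) auto
  have ZB: "Z \<subseteq> B"
  proof
    fix z assume z: "z \<in> Z"
    have "z j \<in> {-M..M}" if j: "j < n" for j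
    proof -
      have "(real_of_int (z j))\<^sup>2 \<le> (\<Sum>j<n. (real_of_int (z j))\<^sup>2)" using j
        by (intro member_le_sum) auto
      also have "\<dots> \<le> T" using z Z by auto
      also have "\<dots> \<le> real_of_int M" by (simp add: M_def)
      finally have "(z j)\<^sup>2 \<le> M" by (simp flip: of_int_power)
      moreover have "\<bar>z j\<bar> \<le> (z j)\<^sup>2"
      proof (cases "z j = 0")
        case False
        then have "\<bar>z j\<bar> * 1 \<le> \<bar>z j\<bar> * \<bar>z j\<bar>" by (intro mult_left_mono) auto
        then show ?thesis by (simp add: power2_eq_square)
      qed simp
      ultimately show ?thesis by auto
    qed
    then show "z \<in> B" using z Z by (auto simp: B_def PiE_def)
  qed
  then show fZ: "finite Z" using fB finite_subset by blast
  have "real (card Z) * exp (- s * T) = (\<Sum>z\<in>Z. exp (- s * T))" by simp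
  also have "\<dots> \<le> (\<Sum>z\<in>Z. \<Prod>j<n. exp (- s * (real_of_int (z j))\<^sup>2))"
  proof (intro sum_mono)
    fix z assume "z \<in> Z"
    then have "(\<Sum>j<n. (real_of_int (z j))\<^sup>2) \<le> T" using Z by auto
    then show "exp (- s * T) \<le> (\<Prod>j<n. exp (- s * (real_of_int (z j))\<^sup>2))"
      using s by (simp add: exp_sum[symmetric] sum_distrib_left[symmetric] sum_negf)
  qed
  also have "\<dots> \<le> (\<Sum>z\<in>B. \<Prod>j<n. exp (- s * (real_of_int (z j))\<^sup>2))"
    using fB ZB by (intro sum_mono2 prod_nonneg) auto
  also have "\<dots> = (\<Prod>j<n. \<Sum>l\<in>{-M..M}. exp (- s * (real_of_int l)\<^sup>2))"
    unfolding B_def by (rule prod_sum_PiE[symmetric]) auto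
  also have "\<dots> \<le> (\<Prod>j<n. 1 + 3 / sqrt s)"
    using sum_exp_neg_square_le[OF s] by (intro prod_mono conjI sum_nonneg) auto
  finally show "real (card Z) \<le> exp (s * T) * (1 + 3 / sqrt s) ^ n"
    by (simp add: exp_minus field_simps)
qed

section \<open>The operator norm\<close>

text \<open>
  An instance of the calculus lemma behind Hoeffding's lemma, for a symmetric sign.
\<close>

lemma cosh_le_exp_half_square: "(exp t + exp (- t)) / 2 \<le> exp (t\<^sup>2 / 2)" for t :: real
proof -
  have pos: "(exp t + exp (- t)) / 2 \<le> exp (t\<^sup>2 / 2)" if t: "t \<ge> 0" for t :: real
  proof -
    have "- (2 * t) * (1/2) + ln (1 + (1/2) * (exp (2 * t) - 1)) \<le> (2 * t)\<^sup>2 / 8"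
      by (rule Hoeffdings_lemma_aux) (use t in auto)
    then have "ln ((1 + exp (2 * t)) / 2) \<le> t\<^sup>2 / 2 + t" by (simp add: field_simps)
    then have "exp (ln ((1 + exp (2 * t)) / 2)) \<le> exp (t\<^sup>2 / 2 + t)" by simp
    then have "(1 + exp (2 * t)) / 2 \<le> exp (t\<^sup>2 / 2 + t)"
      by (subst (asm) exp_ln) (auto simp: add_pos_pos)
    then have "(1 + exp (2 * t)) / 2 * exp (- t) \<le> exp (t\<^sup>2 / 2 + t) * exp (- t)"
      by (intro mult_right_mono) auto
    moreover have "(1 + exp (2 * t)) / 2 * exp (- t) = (exp t + exp (- t)) / 2"
      by (simp add: algebra_simps exp_add[symmetric])
    moreover have "exp (t\<^sup>2 / 2 + t) * exp (- t) = exp (t\<^sup>2 / 2)"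
      by (simp add: exp_add[symmetric])
    ultimately show ?thesis by simp
  qed
  show ?thesis using pos[of t] pos[of "-t"] by (cases "t \<ge> 0") (auto simp: add.commute)
qed

lemma eta_mgf_le:
  assumes "0 \<le> \<mu>" "\<mu> \<le> 1"
  shows "measure_pmf.expectation (eta_pmf \<mu>) (\<lambda>x. exp (t * x)) \<le> exp (t\<^sup>2 / 2)"
proof -
  have "measure_pmf.expectation (eta_pmf \<mu>) (\<lambda>x. exp (t * x))
      = (1 - \<mu>) * 1 + \<mu> * ((exp t + exp (- t)) / 2)"
    using assms by (simp add: expectation_eta_pmf field_simps)
  also have "\<dots> \<le> (1 - \<mu>) * exp (t\<^sup>2 / 2) + \<mu> * exp (t\<^sup>2 / 2)"
    using assms cosh_le_exp_half_square by (intro add_mono mult_left_mono) auto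
  finally show ?thesis by (simp add: algebra_simps)
qed

lemma row_mgf_le:
  assumes "0 \<le> \<mu>" "\<mu> \<le> 1"
  shows "measure_pmf.expectation (row_pmf n \<mu>) (\<lambda>x. exp (t * dot n x d)) \<le> exp (t\<^sup>2 * sqnorm n d / 2)"
proof -
  have "measure_pmf.expectation (row_pmf n \<mu>) (\<lambda>x. exp (t * dot n x d))
      = measure_pmf.expectation (row_pmf n \<mu>) (\<lambda>x. \<Prod>j<n. exp ((t * d j) * x j))"
    by (simp add: dot_def exp_sum[symmetric] sum_distrib_left mult_ac)
  also have "\<dots> = (\<Prod>j<n. measure_pmf.expectation (eta_pmf \<mu>) (\<lambda>x. exp ((t * d j) * x)))"
    unfolding row_pmf_def
    by (intro expectation_prod_Pi_pmf integrable_measure_pmf_finite finite_set_eta_pmf) auto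
  also have "\<dots> \<le> (\<Prod>j<n. exp ((t * d j)\<^sup>2 / 2))"
    using assms by (intro prod_mono conjI eta_mgf_le) auto
  also have "\<dots> = exp (t\<^sup>2 * sqnorm n d / 2)"
    by (simp add: exp_sum[symmetric] sqnorm_def sum_distrib_left power_mult_distrib sum_divide_distrib)
  finally show ?thesis .
qed

lemma bilinear_tail:
  assumes \<mu>: "0 \<le> \<mu>" "\<mu> \<le> 1" and V: "V > 0" "sqnorm n y * sqnorm n d \<le> V" and \<tau>: "\<tau> \<ge> 0"
  shows "measure_pmf.prob (rows_pmf n \<mu>) {R. \<tau> \<le> (\<Sum>i<n. y i * dot n (R i) d)} \<le> exp (- \<tau>\<^sup>2 / (2 * V))"
proof -
  let ?E = "measure_pmf.expectation (rows_pmf n \<mu>)"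
  \<comment> \<open>the optimal exponent in the Chernoff bound\<close>
  define l where "l = \<tau> / V"
  have "exp (l * \<tau>) * measure_pmf.prob (rows_pmf n \<mu>) {R. \<tau> \<le> (\<Sum>i<n. y i * dot n (R i) d)}
      \<le> ?E (\<lambda>R. \<Prod>i<n. exp ((l * y i) * dot n (R i) d))"
  proof (intro prob_le_expectation finite_set_rows_pmf prod_nonneg)
    fix R assume "R \<in> {R. \<tau> \<le> (\<Sum>i<n. y i * dot n (R i) d)}"
    then have "l * \<tau> \<le> l * (\<Sum>i<n. y i * dot n (R i) d)"
      using V \<tau> by (intro mult_left_mono) (auto simp: l_def)
    then show "exp (l * \<tau>) \<le> (\<Prod>i<n. exp ((l * y i) * dot n (R i) d))"
      by (simp add: exp_sum[symmetric] sum_distrib_left mult_ac)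
  qed auto
  also have "\<dots> = (\<Prod>i<n. measure_pmf.expectation (row_pmf n \<mu>) (\<lambda>x. exp ((l * y i) * dot n x d)))"
    unfolding rows_pmf_def
    by (intro expectation_prod_Pi_pmf) auto
  also have "\<dots> \<le> (\<Prod>i<n. exp ((l * y i)\<^sup>2 * sqnorm n d / 2))"
    using \<mu> by (intro prod_mono conjI row_mgf_le) auto
  also have "\<dots> = exp (l\<^sup>2 * (sqnorm n y * sqnorm n d) / 2)"
    by (simp add: exp_sum[symmetric] sqnorm_def sum_distrib_left sum_distrib_right power_mult_distrib
        sum_divide_distrib mult_ac)
  also have "\<dots> \<le> exp (l\<^sup>2 * V / 2)" using V by (simp add: mult_left_mono)
  finally have "measure_pmf.prob (rows_pmf n \<mu>) {R. \<tau> \<le> (\<Sum>i<n. y i * dot n (R i) d)}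
      \<le> exp (l\<^sup>2 * V / 2 - l * \<tau>)"
    by (simp add: exp_diff pos_le_divide_eq mult.commute)
  also have "l\<^sup>2 * V / 2 - l * \<tau> = - \<tau>\<^sup>2 / (2 * V)"
    using V by (simp add: l_def power2_eq_square field_simps)
  finally show ?thesis .
qed

text \<open>
  The mesh \<open>1 / n\<^sup>2\<close> is so fine that rounding changes a bilinear form with \<open>n\<^sup>2\<close> bounded
  coefficients by \<open>O(1)\<close> only. A union bound over the \<open>exp (O(n log n))\<close> grid points is affordable
  because the operator norm bound exceeds \<open>\<surd>n\<close> by a power of \<open>n\<close>.
\<close>

definition grid :: "nat \<Rightarrow> real set" where
  "grid n = (\<lambda>l. real_of_int l / (real n)\<^sup>2) ` {- (int n)\<^sup>2..(int n)\<^sup>2}"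

definition grid_round :: "nat \<Rightarrow> (nat \<Rightarrow> real) \<Rightarrow> nat \<Rightarrow> real" where
  "grid_round n y = (\<lambda>j\<in>{..<n}. real_of_int (round ((real n)\<^sup>2 * y j)) / (real n)\<^sup>2)"

lemma card_grid: "finite (grid n)" "card (grid n) \<le> 2 * n\<^sup>2 + 1"
proof -
  show "finite (grid n)" by (simp add: grid_def)
  have "card (grid n) \<le> card {- (int n)\<^sup>2..(int n)\<^sup>2}" unfolding grid_def by (intro card_image_le) auto
  also have "\<dots> = 2 * n\<^sup>2 + 1" by (simp flip: of_nat_power)
  finally show "card (grid n) \<le> 2 * n\<^sup>2 + 1" .
qed

lemma grid_round:
  assumes n: "n \<ge> 1" and y: "sqnorm n y = 1"
  shows "\<And>j. j < n \<Longrightarrow> \<bar>y j\<bar> \<le> 1"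
    and "\<And>j. j < n \<Longrightarrow> \<bar>grid_round n y j\<bar> \<le> 1"
    and "\<And>j. j < n \<Longrightarrow> \<bar>y j - grid_round n y j\<bar> \<le> 1 / (2 * (real n)\<^sup>2)"
    and "grid_round n y \<in> {z \<in> PiE {..<n} (\<lambda>_. grid n). sqnorm n z \<le> 3}"
proof -
  have n2: "(real n)\<^sup>2 > 0" using n by simp
  show abs_y: "\<bar>y j\<bar> \<le> 1" if "j < n" for j
    using y member_le_sum[of j "{..<n}" "\<lambda>j. (y j)\<^sup>2"] that by (simp add: sqnorm_def abs_square_le_1)
  have rnd: "round ((real n)\<^sup>2 * y j) \<in> {- (int n)\<^sup>2..(int n)\<^sup>2}" if j: "j < n" for j
  proof -
    have "(real n)\<^sup>2 * y j \<le> (real n)\<^sup>2 * 1" "(real n)\<^sup>2 * (-1) \<le> (real n)\<^sup>2 * y j"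
      using abs_y[OF j] by (intro mult_left_mono; simp add: abs_le_iff)+
    then have "(real n)\<^sup>2 * y j \<le> real_of_int ((int n)\<^sup>2)" "real_of_int (- (int n)\<^sup>2) \<le> (real n)\<^sup>2 * y j"
      by auto
    then have "round ((real n)\<^sup>2 * y j) \<le> round (real_of_int ((int n)\<^sup>2))"
        "round (real_of_int (- (int n)\<^sup>2)) \<le> round ((real n)\<^sup>2 * y j)"
      by (metis round_mono)+
    then show ?thesis by (simp only: round_of_int atLeastAtMost_iff)
  qed
  show abs_r: "\<bar>grid_round n y j\<bar> \<le> 1" if j: "j < n" for j
  proof -
    have "\<bar>round ((real n)\<^sup>2 * y j)\<bar> \<le> (int n)\<^sup>2" using rnd[OF j] by auto
    then have "\<bar>real_of_int (round ((real n)\<^sup>2 * y j))\<bar> \<le> (real n)\<^sup>2"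
      by (metis of_int_abs of_int_le_iff of_int_of_nat_eq of_int_power)
    then show ?thesis using j n2 by (simp add: grid_round_def)
  qed
  show diff: "\<bar>y j - grid_round n y j\<bar> \<le> 1 / (2 * (real n)\<^sup>2)" if j: "j < n" for j
  proof -
    have "y j - grid_round n y j = ((real n)\<^sup>2 * y j - real_of_int (round ((real n)\<^sup>2 * y j))) / (real n)\<^sup>2"
      using j n2 by (simp add: grid_round_def field_simps)
    also have "\<bar>\<dots>\<bar> \<le> (1 / 2) / (real n)\<^sup>2"
      unfolding abs_divide using n2 of_int_round_abs_le[of "(real n)\<^sup>2 * y j"]
      by (intro divide_mono) (auto simp: abs_minus_commute)
    finally show ?thesis by simp
  qed
  have "sqnorm n (grid_round n y) \<le> (\<Sum>j<n. 2 * (y j)\<^sup>2 + 1 / real n)"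
    unfolding sqnorm_def
  proof (intro sum_mono)
    fix j assume j: "j \<in> {..<n}"
    let ?g = "grid_round n y j"
    have "0 \<le> (2 * y j - ?g)\<^sup>2" by simp
    then have "?g\<^sup>2 \<le> 2 * (y j)\<^sup>2 + 2 * (y j - ?g)\<^sup>2" by (simp add: power2_eq_square algebra_simps)
    also have "(y j - ?g)\<^sup>2 \<le> (1 / (2 * (real n)\<^sup>2))\<^sup>2"
      using diff[of j] j by (intro abs_le_square_iff[THEN iffD1]) auto
    also have "2 * (1 / (2 * (real n)\<^sup>2))\<^sup>2 \<le> 1 / real n"
    proof -
      have "real n * 1 \<le> real n * (2 * real n ^ 3)"
      proof (intro mult_left_mono)
        show "1 \<le> 2 * real n ^ 3" using n one_le_power[of "real n" 3] by linarith
      qed simp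
      then show ?thesis using n by (simp add: field_simps power2_eq_square power3_eq_cube)
    qed
    finally show "?g\<^sup>2 \<le> 2 * (y j)\<^sup>2 + 1 / real n" by simp
  qed
  also have "\<dots> = 3" using y n by (simp add: sum.distrib sum_distrib_left[symmetric] sqnorm_def)
  finally have "sqnorm n (grid_round n y) \<le> 3" .
  moreover have "grid_round n y \<in> PiE {..<n} (\<lambda>_. grid n)"
    using rnd by (auto simp: grid_round_def grid_def)
  ultimately show "grid_round n y \<in> {z \<in> PiE {..<n} (\<lambda>_. grid n). sqnorm n z \<le> 3}" by simp
qed

text \<open>
  The vector \<open>y\<close> is the normalized image of the normalized \<open>d\<close>, so that the bilinear form equals the
  norm of that image; then both vectors are rounded.
\<close>

lemma large_norm_imp_bilinear:
  assumes n: "n \<ge> 1" and R: "\<And>i j. \<bar>R i j\<bar> \<le> 1" and \<Lambda>: "\<Lambda> \<ge> 0"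
    and d: "\<Lambda>\<^sup>2 * sqnorm n d < (\<Sum>i<n. (dot n (R i) d)\<^sup>2)"
  shows "\<exists>y \<in> {z \<in> PiE {..<n} (\<lambda>_. grid n). sqnorm n z \<le> 3}.
    \<exists>z \<in> {z \<in> PiE {..<n} (\<lambda>_. grid n). sqnorm n z \<le> 3}.
    \<Lambda> - 1 \<le> (\<Sum>i<n. y i * dot n (R i) z)"
proof -
  have "sqnorm n d \<noteq> 0"
  proof
    assume "sqnorm n d = 0"
    then have "\<forall>j<n. d j = 0" by (auto simp: sqnorm_def sum_nonneg_eq_0_iff)
    then have "dot n x d = 0" for x by (simp add: dot_def)
    with d \<open>sqnorm n d = 0\<close> show False by simp
  qed
  then have sd: "sqnorm n d > 0" using sqnorm_nonneg[of n d] by linarith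
  define e where "e = (\<lambda>j. (1 / sqrt (sqnorm n d)) * d j)"
  have e: "sqnorm n e = 1" unfolding e_def sqnorm_scale using sd by (simp add: power_divide)
  define u where "u = (\<lambda>i. dot n (R i) e)"
  have "u i = (1 / sqrt (sqnorm n d)) * dot n (R i) d" for i
    unfolding u_def e_def dot_scale ..
  then have "sqnorm n u = (1 / sqnorm n d) * (\<Sum>i<n. (dot n (R i) d)\<^sup>2)"
    unfolding sum_distrib_left using sd by (simp add: sqnorm_def[of n u] power_divide)
  then have "sqnorm n d * sqnorm n u = (\<Sum>i<n. (dot n (R i) d)\<^sup>2)" using sd by simp
  then have "sqnorm n d * \<Lambda>\<^sup>2 < sqnorm n d * sqnorm n u" using d by (metis mult.commute)
  then have u: "\<Lambda>\<^sup>2 < sqnorm n u" by (rule mult_left_less_imp_less) (use sd in simp)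
  then have su: "sqnorm n u > 0" using zero_le_power2[of \<Lambda>] by linarith
  define y where "y = (\<lambda>i. (1 / sqrt (sqnorm n u)) * u i)"
  have y: "sqnorm n y = 1" unfolding y_def sqnorm_scale using su by (simp add: power_divide)
  have yu: "(\<Sum>i<n. y i * u i) = sqrt (sqnorm n u)"
  proof -
    have "(\<Sum>i<n. y i * u i) = (1 / sqrt (sqnorm n u)) * sqnorm n u"
      by (simp add: y_def sqnorm_def[of n u] sum_divide_distrib power2_eq_square)
    then show ?thesis using su by (simp add: real_div_sqrt)
  qed
  have "\<Lambda> \<le> sqrt (sqnorm n u)" using u by (intro real_le_rsqrt) simp
  note ry = grid_round[OF n y] and re = grid_round[OF n e]
  let ?y = "grid_round n y" and ?e = "grid_round n e"
  have "(\<Sum>i<n. y i * u i) - (\<Sum>i<n. ?y i * dot n (R i) ?e)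
      = (\<Sum>i<n. \<Sum>j<n. R i j * (y i * e j - ?y i * ?e j))"
    unfolding u_def dot_def sum_distrib_left sum_subtractf[symmetric] by (simp add: algebra_simps)
  also have "\<dots> \<le> (\<Sum>i<n. \<Sum>j<n. 1 / (real n)\<^sup>2)"
  proof (intro sum_mono)
    fix i j assume i: "i \<in> {..<n}" and j: "j \<in> {..<n}"
    have "y i * e j - ?y i * ?e j = y i * (e j - ?e j) + (y i - ?y i) * ?e j"
      by (simp add: algebra_simps)
    also have "\<bar>\<dots>\<bar> \<le> \<bar>y i\<bar> * \<bar>e j - ?e j\<bar> + \<bar>y i - ?y i\<bar> * \<bar>?e j\<bar>"
      by (metis abs_mult abs_triangle_ineq)
    also have "\<dots> \<le> 1 * (1 / (2 * (real n)\<^sup>2)) + (1 / (2 * (real n)\<^sup>2)) * 1"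
      using i j ry re by (intro add_mono mult_mono) auto
    also have "\<dots> = 1 / (real n)\<^sup>2" by simp
    finally have le: "\<bar>y i * e j - ?y i * ?e j\<bar> \<le> 1 / (real n)\<^sup>2" .
    have "R i j * (y i * e j - ?y i * ?e j) \<le> \<bar>R i j\<bar> * \<bar>y i * e j - ?y i * ?e j\<bar>"
      by (metis abs_ge_self abs_mult)
    also have "\<dots> \<le> 1 * (1 / (real n)\<^sup>2)" using le R by (intro mult_mono) auto
    finally show "R i j * (y i * e j - ?y i * ?e j) \<le> 1 / (real n)\<^sup>2" by simp
  qed
  also have "\<dots> = 1" using n by (simp add: power2_eq_square)
  finally have "\<Lambda> - 1 \<le> (\<Sum>i<n. ?y i * dot n (R i) ?e)"
    using yu \<open>\<Lambda> \<le> sqrt (sqnorm n u)\<close> by simp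
  with ry(4) re(4) show ?thesis by blast
qed

lemma prob_norm_large_le:
  assumes \<mu>: "0 \<le> \<mu>" "\<mu> \<le> 1" and n: "n \<ge> 1" and \<Lambda>: "\<Lambda> \<ge> 1"
  shows "measure_pmf.prob (rows_pmf n \<mu>) {R. \<exists>d. \<Lambda>\<^sup>2 * sqnorm n d < (\<Sum>i<n. (dot n (R i) d)\<^sup>2)}
    \<le> (2 * (real n)\<^sup>2 + 1) ^ (2 * n) * exp (- (\<Lambda> - 1)\<^sup>2 / 18)"
proof -
  let ?P = "measure_pmf.prob (rows_pmf n \<mu>)"
  define G where "G = {z \<in> PiE {..<n} (\<lambda>_. grid n). sqnorm n z \<le> 3}"
  define H where "H = (\<lambda>(y, z). {R. \<Lambda> - 1 \<le> (\<Sum>i<n. y i * dot n (R i) z)})"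
  have fin: "finite (PiE {..<n} (\<lambda>_. grid n))" by (intro finite_PiE card_grid) auto
  then have fG: "finite G" by (simp add: G_def)
  have "card G \<le> card (PiE {..<n} (\<lambda>_. grid n))" using fin by (intro card_mono) (auto simp: G_def)
  also have "\<dots> = card (grid n) ^ n" by (simp add: card_PiE)
  also have "\<dots> \<le> (2 * n\<^sup>2 + 1) ^ n" by (intro power_mono card_grid) auto
  finally have "real (card G) \<le> real ((2 * n\<^sup>2 + 1) ^ n)" by (rule of_nat_mono)
  then have cG: "real (card G) \<le> (2 * (real n)\<^sup>2 + 1) ^ n" by (simp add: add.commute)
  have "?P {R. \<exists>d. \<Lambda>\<^sup>2 * sqnorm n d < (\<Sum>i<n. (dot n (R i) d)\<^sup>2)}
      = ?P ({R. \<exists>d. \<Lambda>\<^sup>2 * sqnorm n d < (\<Sum>i<n. (dot n (R i) d)\<^sup>2)} \<inter> set_pmf (rows_pmf n \<mu>))"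
    by (simp add: measure_Int_set_pmf)
  also have "\<dots> \<le> ?P (\<Union>yz\<in>G \<times> G. H yz)"
  proof (intro measure_pmf.finite_measure_mono subsetI)
    fix R assume "R \<in> {R. \<exists>d. \<Lambda>\<^sup>2 * sqnorm n d < (\<Sum>i<n. (dot n (R i) d)\<^sup>2)} \<inter> set_pmf (rows_pmf n \<mu>)"
    then obtain d where d: "\<Lambda>\<^sup>2 * sqnorm n d < (\<Sum>i<n. (dot n (R i) d)\<^sup>2)"
      and R: "R \<in> set_pmf (rows_pmf n \<mu>)" by auto
    have "0 \<le> \<Lambda>" using \<Lambda> by simp
    from large_norm_imp_bilinear[where R = R, OF n abs_rows_pmf_le_1[OF R] this d, folded G_def]
    obtain y z where "y \<in> G" "z \<in> G" "R \<in> H (y, z)" unfolding H_def by blast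
    then show "R \<in> (\<Union>yz\<in>G \<times> G. H yz)" by blast
  qed auto
  also have "\<dots> \<le> (\<Sum>yz\<in>G \<times> G. ?P (H yz))"
    using fG by (intro measure_pmf.finite_measure_subadditive_finite) auto
  also have "\<dots> \<le> (\<Sum>yz\<in>G \<times> G. exp (- (\<Lambda> - 1)\<^sup>2 / 18))"
  proof (intro sum_mono)
    fix yz assume "yz \<in> G \<times> G"
    then obtain y z where yz: "yz = (y, z)" "sqnorm n y \<le> 3" "sqnorm n z \<le> 3" by (auto simp: G_def)
    have "sqnorm n y * sqnorm n z \<le> 3 * 3" using yz by (intro mult_mono) auto
    then show "?P (H yz) \<le> exp (- (\<Lambda> - 1)\<^sup>2 / 18)"
      using bilinear_tail[OF \<mu>, of 9 n y z "\<Lambda> - 1"] \<Lambda> by (simp add: H_def yz)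
  qed
  also have "\<dots> = real (card G) * real (card G) * exp (- (\<Lambda> - 1)\<^sup>2 / 18)"
    by (simp add: card_cartesian_product)
  also have "\<dots> \<le> ((2 * (real n)\<^sup>2 + 1) ^ n * (2 * (real n)\<^sup>2 + 1) ^ n) * exp (- (\<Lambda> - 1)\<^sup>2 / 18)"
    using cG by (intro mult_right_mono mult_mono) auto
  finally show ?thesis by (simp only: power_even_eq power2_eq_square[of "_ ^ _"])
qed

section \<open>Normal vectors close to the lattice\<close>

text \<open>
  The union bound over lattice points. All \<open>v \<in> V\<close> for which \<open>k v\<close> rounds to the same \<open>z\<close> differ
  from the representative \<open>w z\<close> by at most \<open>2 L / k\<close>. If one of them is orthogonal to the rows in
  \<open>J\<close> and the operator norm is at most \<open>\<Lambda>\<close>, then those rows map \<open>w z\<close> to a vector of norm at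
  most \<open>2 \<Lambda> L / k\<close>. The
  representative is taken from \<open>V\<close> itself, and not as \<open>z / k\<close>, because the small ball bound \<open>p\<close> is known on
  \<open>V\<close> only.
\<close>

lemma level_set_orthogonal:
  fixes k n :: nat and V :: "(nat \<Rightarrow> real) set"
  assumes k: "k > 0" and L: "0 \<le> L" "L \<le> real k"
    and s: "s > 0" and b: "b > 0" and \<rho>: "\<rho> \<ge> 0" and p: "p \<ge> 0" and J: "J \<subseteq> {..<n}"
    and V1: "\<And>v. v \<in> V \<Longrightarrow> sqnorm n v = 1"
    and V2: "\<And>v. v \<in> V \<Longrightarrow> lattice_sqdist n (\<lambda>j. real k * v j) \<le> L\<^sup>2"
    and V3: "\<And>v. v \<in> V \<Longrightarrow> measure_pmf.prob (row_pmf n \<mu>) {x. \<bar>dot n x v\<bar> \<le> \<rho>} \<le> p"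
  shows "measure_pmf.prob (rows_pmf n \<mu>)
      ({R. \<exists>v\<in>V. \<forall>i\<in>J. dot n (R i) v = 0} - {R. \<exists>d. \<Lambda>\<^sup>2 * sqnorm n d < (\<Sum>i<n. (dot n (R i) d)\<^sup>2)})
    \<le> (exp (4 * s * (real k)\<^sup>2) * (1 + 3 / sqrt s) ^ n) *
        (exp (4 * \<Lambda>\<^sup>2 * L\<^sup>2 / (real k)\<^sup>2 / b\<^sup>2) * (p + exp (- (\<rho>\<^sup>2 / b\<^sup>2))) ^ card J)"
    (is "?P (?E - ?O) \<le> ?C * ?Q")
proof -
  define zr where "zr = (\<lambda>v. \<lambda>j\<in>{..<n}. round (real k * v j))"
  define Z where "Z = zr ` V"
  define w where "w = inv_into V zr"
  define a2 where "a2 = 4 * \<Lambda>\<^sup>2 * L\<^sup>2 / (real k)\<^sup>2"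
  have w: "w z \<in> V" "zr (w z) = z" if "z \<in> Z" for z
    using that unfolding w_def Z_def by (metis inv_into_into, metis f_inv_into_f)
  have "Z \<subseteq> {z \<in> extensional {..<n}. (\<Sum>j<n. (real_of_int (z j))\<^sup>2) \<le> 4 * (real k)\<^sup>2}"
  proof (clarsimp simp: Z_def)
    fix v assume v: "v \<in> V"
    have "(\<Sum>j<n. (real_of_int (zr v j))\<^sup>2)
        \<le> (\<Sum>j<n. 2 * (real k)\<^sup>2 * (v j)\<^sup>2 + 2 * (real k * v j - real_of_int (round (real k * v j)))\<^sup>2)"
    proof (intro sum_mono)
      fix j assume j: "j \<in> {..<n}"
      define a c where "a = real k * v j" and "c = real_of_int (round (real k * v j))"
      have "0 \<le> (2 * a - c)\<^sup>2" by simp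
      then have "c\<^sup>2 \<le> 2 * a\<^sup>2 + 2 * (a - c)\<^sup>2" by (simp add: power2_eq_square algebra_simps)
      then show "(real_of_int (zr v j))\<^sup>2 \<le> 2 * (real k)\<^sup>2 * (v j)\<^sup>2
          + 2 * (real k * v j - real_of_int (round (real k * v j)))\<^sup>2"
        using j by (simp add: zr_def a_def c_def power_mult_distrib)
    qed
    also have "\<dots> = 2 * (real k)\<^sup>2 * sqnorm n v + 2 * lattice_sqdist n (\<lambda>j. real k * v j)"
      by (simp add: sum.distrib sum_distrib_left sqnorm_def lattice_sqdist_def)
    also have "\<dots> \<le> 2 * (real k)\<^sup>2 + 2 * (real k)\<^sup>2"
    proof -
      have "L\<^sup>2 \<le> (real k)\<^sup>2" using L by (intro power_mono) auto
      then show ?thesis using V1[OF v] V2[OF v] by simp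
    qed
    finally show "zr v \<in> extensional {..<n} \<and> (\<Sum>j<n. (real_of_int (zr v j))\<^sup>2) \<le> 4 * (real k)\<^sup>2"
      by (simp add: zr_def)
  qed
  note Z = card_lattice_points_le[OF s this]
  have sub: "?E - ?O \<subseteq> (\<Union>z\<in>Z. {R. (\<Sum>i\<in>J. (dot n (R i) (w z))\<^sup>2) \<le> a2})"
  proof
    fix R assume R: "R \<in> ?E - ?O"
    then obtain v where v: "v \<in> V" "\<And>i. i \<in> J \<Longrightarrow> dot n (R i) v = 0" by blast
    define u where "u = w (zr v)"
    have zZ: "zr v \<in> Z" using v by (simp add: Z_def)
    have u: "u \<in> V" "zr u = zr v" using w[OF zZ] by (auto simp: u_def)
    define d where "d = (\<lambda>j. u j - v j)"
    have "(real k)\<^sup>2 * sqnorm n d \<le> (\<Sum>j<n. 2 * (real k * u j - real_of_int (round (real k * u j)))\<^sup>2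
        + 2 * (real k * v j - real_of_int (round (real k * v j)))\<^sup>2)"
      unfolding sqnorm_def sum_distrib_left
    proof (intro sum_mono)
      fix j assume j: "j \<in> {..<n}"
      have eq: "round (real k * v j) = round (real k * u j)"
        using fun_cong[OF u(2), of j] j by (simp add: zr_def)
      define a c z where "a = real k * u j" and "c = real k * v j"
        and "z = real_of_int (round (real k * u j))"
      have "0 \<le> (a + c - 2 * z)\<^sup>2" by simp
      then have "(a - c)\<^sup>2 \<le> 2 * (a - z)\<^sup>2 + 2 * (c - z)\<^sup>2"
        by (simp add: power2_eq_square algebra_simps)
      moreover have "(real k)\<^sup>2 * (d j)\<^sup>2 = (a - c)\<^sup>2"
        by (simp add: a_def c_def d_def power_mult_distrib[symmetric] right_diff_distrib)
      ultimately show "(real k)\<^sup>2 * (d j)\<^sup>2 \<le> 2 * (real k * u j - real_of_int (round (real k * u j)))\<^sup>2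
        + 2 * (real k * v j - real_of_int (round (real k * v j)))\<^sup>2"
        unfolding eq by (simp add: a_def c_def z_def)
    qed
    also have "\<dots> = 2 * lattice_sqdist n (\<lambda>j. real k * u j) + 2 * lattice_sqdist n (\<lambda>j. real k * v j)"
      by (simp add: sum.distrib sum_distrib_left lattice_sqdist_def)
    also have "\<dots> \<le> 4 * L\<^sup>2" using V2[OF u(1)] V2[OF v(1)] by simp
    finally have "sqnorm n d \<le> 4 * L\<^sup>2 / (real k)\<^sup>2"
      using k by (simp add: pos_le_divide_eq mult.commute)
    then have "\<Lambda>\<^sup>2 * sqnorm n d \<le> \<Lambda>\<^sup>2 * (4 * L\<^sup>2 / (real k)\<^sup>2)" by (intro mult_left_mono) auto
    then have bound: "\<Lambda>\<^sup>2 * sqnorm n d \<le> a2" by (simp add: a2_def mult_ac)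
    have "(\<Sum>i\<in>J. (dot n (R i) u)\<^sup>2) = (\<Sum>i\<in>J. (dot n (R i) d)\<^sup>2)"
    proof (intro sum.cong refl)
      fix i assume "i \<in> J"
      moreover have "dot n (R i) d = dot n (R i) u - dot n (R i) v"
        by (simp add: dot_def d_def right_diff_distrib sum_subtractf)
      ultimately show "(dot n (R i) u)\<^sup>2 = (dot n (R i) d)\<^sup>2" using v by simp
    qed
    also have "\<dots> \<le> (\<Sum>i<n. (dot n (R i) d)\<^sup>2)" using J by (intro sum_mono2) auto
    also have "\<dots> \<le> \<Lambda>\<^sup>2 * sqnorm n d" using R by (auto simp: not_less)
    also have "\<dots> \<le> a2" by (rule bound)
    finally show "R \<in> (\<Union>z\<in>Z. {R. (\<Sum>i\<in>J. (dot n (R i) (w z))\<^sup>2) \<le> a2})"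
      using zZ by (auto simp: u_def)
  qed
  have "?P (?E - ?O) \<le> ?P (\<Union>z\<in>Z. {R. (\<Sum>i\<in>J. (dot n (R i) (w z))\<^sup>2) \<le> a2})"
    by (intro measure_pmf.finite_measure_mono sub) auto
  also have "\<dots> \<le> (\<Sum>z\<in>Z. ?P {R. (\<Sum>i\<in>J. (dot n (R i) (w z))\<^sup>2) \<le> a2})"
    using Z by (intro measure_pmf.finite_measure_subadditive_finite) auto
  also have "\<dots> \<le> (\<Sum>z\<in>Z. ?Q)"
    unfolding a2_def using V3 w(1) J b \<rho> by (intro sum_mono prob_rows_small_le) auto
  also have "\<dots> = real (card Z) * ?Q" by simp
  also have "\<dots> \<le> ?C * ?Q"
    using Z(2) p by (intro mult_right_mono mult_nonneg_nonneg) (auto simp: mult_ac)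
  finally show ?thesis .
qed

lemma one_plus_power_le_exp: "0 \<le> x \<Longrightarrow> (1 + x) ^ n \<le> exp (real n * x)"
  by (metis add_nonneg_nonneg exp_ge_add_one_self exp_of_nat_mult power_mono zero_le_one)

lemma power_add_divide: "q > 0 \<Longrightarrow> c * q ^ (i + j) / q ^ j = c * (q :: real) ^ i"
  by (simp add: power_add)

lemma divide_power_add: "q > 0 \<Longrightarrow> c * q ^ j / q ^ (j + i) = c / (q :: real) ^ i"
  by (simp add: power_add)

text \<open>
  In \<open>level_set_orthogonal\<close> take \<open>s = q\<^sup>2\<close>, which makes the number of lattice points
  \<open>exp (o(q ^ 40))\<close>, and the crude small ball bound at the constant scale \<open>c\<close>, with \<open>b = 1 / q\<close>.
\<close>

lemma orthogonal_small_scale: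
  fixes n k :: nat and q c p :: real
  assumes q: "q \<ge> 1" "q ^ 40 = real n" and J: "J \<subseteq> {..<n}" "card J = n - 1"
    and k: "q ^ 4 \<le> real k" "real k \<le> q ^ 11"
    and c: "c > 0" and p0: "p \<ge> 0"
    and p: "\<And>v. sqnorm n v = 1 \<Longrightarrow> measure_pmf.prob (row_pmf n \<mu>) {x. \<bar>dot n x v\<bar> \<le> c} \<le> p"
    and V: "\<And>v. v \<in> V \<Longrightarrow> sqnorm n v = 1 \<and> lattice_sqdist n (\<lambda>j. real k * v j) \<le> q\<^sup>2"
  shows "measure_pmf.prob (rows_pmf n \<mu>)
      ({R. \<exists>v\<in>V. \<forall>i\<in>J. dot n (R i) v = 0}
        - {R. \<exists>d. (q ^ 21)\<^sup>2 * sqnorm n d < (\<Sum>i<n. (dot n (R i) d)\<^sup>2)})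
    \<le> exp (4 * q ^ 24 + 3 * q ^ 39 + 4 * q ^ 38) * (p + exp (- (c\<^sup>2 * q\<^sup>2))) ^ (n - 1)"
proof -
  have qk: "q \<le> real k" using k(1) q power_increasing[of 1 4 q] by simp
  have k0: "k > 0" using qk q by (cases k) auto
  have "measure_pmf.prob (rows_pmf n \<mu>)
      ({R. \<exists>v\<in>V. \<forall>i\<in>J. dot n (R i) v = 0}
        - {R. \<exists>d. (q ^ 21)\<^sup>2 * sqnorm n d < (\<Sum>i<n. (dot n (R i) d)\<^sup>2)})
    \<le> (exp (4 * q\<^sup>2 * (real k)\<^sup>2) * (1 + 3 / sqrt (q\<^sup>2)) ^ n) *
        (exp (4 * (q ^ 21)\<^sup>2 * q\<^sup>2 / (real k)\<^sup>2 / (1 / q)\<^sup>2) * (p + exp (- (c\<^sup>2 / (1 / q)\<^sup>2))) ^ card J)"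
    by (rule level_set_orthogonal) (use k0 qk q J c p p0 V in auto)
  also have "\<dots> \<le> (exp (4 * q ^ 24) * exp (3 * q ^ 39)) * (exp (4 * q ^ 38) * (p + exp (- (c\<^sup>2 * q\<^sup>2))) ^ (n - 1))"
  proof (intro mult_mono)
    have "(real k)\<^sup>2 \<le> (q ^ 11)\<^sup>2" using k by (intro power_mono) auto
    then have "4 * q\<^sup>2 * (real k)\<^sup>2 \<le> 4 * q\<^sup>2 * (q ^ 11)\<^sup>2" by (intro mult_left_mono) auto
    also have "\<dots> = 4 * q ^ 24" by (simp add: power_mult[symmetric] power_add[symmetric])
    finally show "exp (4 * q\<^sup>2 * (real k)\<^sup>2) \<le> exp (4 * q ^ 24)" by simp
    have "(1 + 3 / sqrt (q\<^sup>2)) ^ n \<le> exp (real n * (3 / sqrt (q\<^sup>2)))"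
      by (rule one_plus_power_le_exp) simp
    also have "real n * (3 / sqrt (q\<^sup>2)) = 3 * q ^ 39"
      using q(1) unfolding q(2)[symmetric] by (simp add: power_Suc[of q 39, simplified])
    finally show "(1 + 3 / sqrt (q\<^sup>2)) ^ n \<le> exp (3 * q ^ 39)" .
    have "(q ^ 4)\<^sup>2 \<le> (real k)\<^sup>2" using k q by (intro power_mono) auto
    then have "4 * (q ^ 21)\<^sup>2 * q\<^sup>2 / (real k)\<^sup>2 / (1 / q)\<^sup>2 \<le> 4 * (q ^ 21)\<^sup>2 * q\<^sup>2 / (q ^ 4)\<^sup>2 / (1 / q)\<^sup>2"
      using q k0 by (intro divide_right_mono divide_left_mono) auto
    also have "\<dots> = 4 * q ^ 46 / q ^ 8"
      by (simp add: power_divide power_mult[symmetric] power_add[symmetric])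
    also have "\<dots> = 4 * q ^ 38" using q(1) power_add_divide[of q 4 38 8] by simp
    finally show "exp (4 * (q ^ 21)\<^sup>2 * q\<^sup>2 / (real k)\<^sup>2 / (1 / q)\<^sup>2) \<le> exp (4 * q ^ 38)" by simp
    show "(p + exp (- (c\<^sup>2 / (1 / q)\<^sup>2))) ^ card J \<le> (p + exp (- (c\<^sup>2 * q\<^sup>2))) ^ (n - 1)"
      using q J by (simp add: power_divide)
  qed (use q p0 in auto)
  finally show ?thesis by (simp add: exp_add mult_ac)
qed

text \<open>
  In \<open>level_set_orthogonal\<close> take \<open>s = n / (4 k\<^sup>2)\<close>, which balances the two factors of the lattice
  point count. Since \<open>far\<close> expresses that \<open>k\<close> is least, \<open>small_ball\<close> is available for every \<open>N \<le> k\<close>. The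
  choice \<open>N \<approx> k / q ^ 4\<close> makes the scale \<open>\<rho>\<close> exceed the error per row, about
  \<open>2 q\<^sup>2 / k\<close>, by a factor of order \<open>q\<^sup>2\<close>; this leaves room for \<open>b = \<rho> / q\<close>, for which both
  exponentials in \<open>prob_rows_small_le\<close> are harmless.
\<close>

lemma orthogonal_large_scale:
  fixes n k :: nat and q K :: real
  assumes \<mu>: "0 \<le> \<mu>" "\<mu> \<le> 1"
    and q: "q \<ge> 2" "q ^ 40 = real n" and J: "J \<subseteq> {..<n}" "card J = n - 1"
    and k: "q ^ 11 \<le> real k" "real k \<le> K"
    and K: "5 * exp (- (\<mu> / 2) * q\<^sup>2) \<le> q ^ 8 / K"
    and V: "\<And>v. v \<in> V \<Longrightarrow> sqnorm n v = 1 \<and> lattice_sqdist n (\<lambda>j. real k * v j) \<le> q\<^sup>2"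
    and far: "\<And>v k'. v \<in> V \<Longrightarrow> q ^ 4 \<le> real k' \<Longrightarrow> k' < k \<Longrightarrow> q\<^sup>2 \<le> lattice_sqdist n (\<lambda>j. real k' * v j)"
  shows "measure_pmf.prob (rows_pmf n \<mu>)
      ({R. \<exists>v\<in>V. \<forall>i\<in>J. dot n (R i) v = 0}
        - {R. \<exists>d. (q ^ 21)\<^sup>2 * sqnorm n d < (\<Sum>i<n. (dot n (R i) d)\<^sup>2)})
    \<le> exp (q ^ 40 + 36 * q ^ 38) * (1 + 6 * K) * (300 / q ^ 3) ^ (n - 1)"
proof -
  have qpos: "q > 0" using q by simp
  have qmono: "q ^ i \<le> q ^ j" if "i \<le> j" for i j using q that by (intro power_increasing) auto
  have "q ^ 4 * 2 \<le> q ^ 4 * q ^ 7"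
    using q power_increasing[of 1 7 q] by (intro mult_left_mono) auto
  also have "q ^ 4 * q ^ 7 = q ^ 11" by (simp add: power_add[symmetric])
  finally have k4: "2 * q ^ 4 \<le> real k" using k by simp
  have q4: "1 \<le> q ^ 4" using q by (intro one_le_power) auto
  have kpos: "real k > 0" using k4 q4 by linarith
  define \<kappa> where "\<kappa> = nat \<lceil>q ^ 4\<rceil>"
  define N where "N = nat \<lfloor>real k / q ^ 4\<rfloor>"
  have \<kappa>: "q ^ 4 \<le> real \<kappa>" "real \<kappa> \<le> q ^ 4 + 1"
    using q4 by (auto simp: \<kappa>_def)
  have div2: "2 \<le> real k / q ^ 4" using k4 qpos by (simp add: pos_le_divide_eq)
  have N: "real N \<le> real k / q ^ 4" "real k / q ^ 4 - 1 < real N"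
    using div2 by (auto simp: N_def)
  then have N2: "real k / (2 * q ^ 4) \<le> real N" using div2 by simp
  have Npos: "N > 0" using N(2) div2 by (cases N) auto
  have Nk: "N \<le> k"
  proof -
    have "real k / q ^ 4 \<le> real k" using q4 kpos by (simp add: divide_le_eq)
    then show ?thesis using N(1) by linarith
  qed
  define \<rho> where "\<rho> = q ^ 4 / (3 * real k)"
  define b where "b = q ^ 3 / (3 * real k)"
  define ex where "ex = exp (- (\<mu> / 2) * q\<^sup>2)"
  define p where "p = 40 * q ^ 8 / real k + 4 * ex"
  have small: "measure_pmf.prob (row_pmf n \<mu>) {x. \<bar>dot n x v\<bar> \<le> \<rho>} \<le> p" if v: "v \<in> V" for v
  proof -
    have "\<rho> \<le> 1 / (3 * real N)"
    proof -
      have "real N * q ^ 4 \<le> real k" using N(1) qpos by (simp add: pos_le_divide_eq)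
      then show ?thesis using kpos Npos by (simp add: \<rho>_def field_simps)
    qed
    then have "measure_pmf.prob (row_pmf n \<mu>) {x. \<bar>dot n x v\<bar> \<le> \<rho>}
        \<le> measure_pmf.prob (row_pmf n \<mu>) {x. \<bar>dot n x v\<bar> \<le> 1 / (3 * real N)}"
      by (intro measure_pmf.finite_measure_mono) auto
    also have "\<dots> \<le> 4 * ((2 * real \<kappa> + 1) / real N + ex)"
      unfolding ex_def
    proof (rule small_ball[OF \<mu> Npos])
      fix k' assume "\<kappa> \<le> k'" "k' < N"
      then show "q\<^sup>2 \<le> lattice_sqdist n (\<lambda>j. real k' * v j)" using \<kappa> Nk by (intro far[OF v]) linarith+
    qed
    also have "(2 * real \<kappa> + 1) / real N \<le> (5 * q ^ 4) / (real k / (2 * q ^ 4))"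
      using \<kappa> q4 N2 kpos qpos by (intro frac_le) auto
    also have "\<dots> = 10 * (q ^ 4 * q ^ 4) / real k" by (simp add: field_simps)
    also have "q ^ 4 * q ^ 4 = q ^ 8" by (simp add: power_add[symmetric])
    finally show ?thesis by (simp add: p_def)
  qed
  have p_le: "p + exp (- q\<^sup>2) \<le> 41 * q ^ 8 / real k"
  proof -
    have "\<mu> / 2 * q\<^sup>2 \<le> 1 * q\<^sup>2" using \<mu> by (intro mult_right_mono) auto
    then have "exp (- q\<^sup>2) \<le> ex" by (simp add: ex_def)
    moreover have "5 * ex \<le> q ^ 8 / K" using K by (simp add: ex_def)
    moreover have "q ^ 8 / K \<le> q ^ 8 / real k" using k kpos qpos by (intro divide_left_mono) auto
    ultimately show ?thesis by (simp add: p_def)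
  qed
  have p0: "0 \<le> p" using qpos kpos by (simp add: p_def ex_def)
  have qk: "q \<le> real k" using k4 qmono[of 1 4] qpos by simp
  have npos: "real n > 0" using q qpos by (metis zero_less_power)
  have rn: "sqrt (real n) = q ^ 20"
    using qpos unfolding q(2)[symmetric] by (intro real_sqrt_unique) (auto simp: power_mult[symmetric])
  define s where "s = real n / (4 * (real k)\<^sup>2)"
  have s: "s > 0" using npos kpos by (simp add: s_def)
  have rs: "sqrt s = q ^ 20 / (2 * real k)"
    by (simp add: s_def real_sqrt_divide real_sqrt_mult rn)
  have "measure_pmf.prob (rows_pmf n \<mu>)
      ({R. \<exists>v\<in>V. \<forall>i\<in>J. dot n (R i) v = 0}
        - {R. \<exists>d. (q ^ 21)\<^sup>2 * sqnorm n d < (\<Sum>i<n. (dot n (R i) d)\<^sup>2)})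
    \<le> (exp (4 * s * (real k)\<^sup>2) * (1 + 3 / sqrt s) ^ n) *
        (exp (4 * (q ^ 21)\<^sup>2 * q\<^sup>2 / (real k)\<^sup>2 / b\<^sup>2) * (p + exp (- (\<rho>\<^sup>2 / b\<^sup>2))) ^ card J)"
    by (rule level_set_orthogonal) (use kpos qk qpos J V small s p0 in \<open>auto simp: b_def \<rho>_def\<close>)
  also have "4 * s * (real k)\<^sup>2 = q ^ 40" using kpos q by (simp add: s_def)
  also have "3 / sqrt s = 6 * real k / q ^ 20" by (simp add: rs)
  also have "\<rho>\<^sup>2 / b\<^sup>2 = q\<^sup>2"
  proof -
    have "\<rho> = q * b" by (simp add: \<rho>_def b_def power_Suc[of q 3, simplified])
    moreover have "b \<noteq> 0" using kpos qpos by (simp add: b_def)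
    ultimately show ?thesis by (simp add: power_mult_distrib)
  qed
  also have "4 * (q ^ 21)\<^sup>2 * q\<^sup>2 / (real k)\<^sup>2 / b\<^sup>2 = 36 * q ^ 38"
  proof -
    have "(real k)\<^sup>2 * b\<^sup>2 = q ^ 6 / 9"
      using kpos by (simp add: b_def power_mult_distrib[symmetric]) (simp add: power_divide power_mult[symmetric])
    then have "4 * (q ^ 21)\<^sup>2 * q\<^sup>2 / (real k)\<^sup>2 / b\<^sup>2 = 4 * (q ^ 21)\<^sup>2 * q\<^sup>2 / (q ^ 6 / 9)"
      by (simp only: divide_divide_eq_left)
    also have "\<dots> = 36 * q ^ 44 / q ^ 6" by (simp add: power_mult[symmetric] power_add[symmetric])
    also have "\<dots> = 36 * q ^ 38" using qpos power_add_divide[of q 36 38 6] by simp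
    finally show ?thesis .
  qed
  also have "exp (q ^ 40) * (1 + 6 * real k / q ^ 20) ^ n * (exp (36 * q ^ 38) * (p + exp (- q\<^sup>2)) ^ card J)
      \<le> exp (q ^ 40) * (1 + 6 * real k / q ^ 20) ^ n * (exp (36 * q ^ 38) * (41 * q ^ 8 / real k) ^ (n - 1))"
    unfolding J(2) using p0 p_le qpos by (intro mult_left_mono power_mono) auto
  also have "exp (q ^ 40) * (1 + 6 * real k / q ^ 20) ^ n * (exp (36 * q ^ 38) * (41 * q ^ 8 / real k) ^ (n - 1))
      = exp (q ^ 40 + 36 * q ^ 38) * ((1 + 6 * real k / q ^ 20) *
          ((1 + 6 * real k / q ^ 20) * (41 * q ^ 8 / real k)) ^ (n - 1))"
  proof -
    have "e1 * X ^ n * (e2 * Y ^ (n - 1)) = e1 * e2 * (X * (X * Y) ^ (n - 1))" for e1 e2 X Y :: real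
      using npos by (cases n) (auto simp: power_mult_distrib)
    then show ?thesis by (simp only: exp_add)
  qed
  also have "\<dots> \<le> exp (q ^ 40 + 36 * q ^ 38) * ((1 + 6 * K) * (300 / q ^ 3) ^ (n - 1))"
  proof (intro mult_left_mono mult_mono power_mono)
    have "1 \<le> q ^ 20" using q by (intro one_le_power) auto
    then have "6 * real k / q ^ 20 \<le> 6 * real k / 1" by (intro divide_left_mono) auto
    then show "1 + 6 * real k / q ^ 20 \<le> 1 + 6 * K" using k by simp
    have "41 * q ^ 8 / real k \<le> 41 * q ^ 8 / q ^ 11"
      using k qpos kpos by (intro divide_left_mono) auto
    also have "\<dots> = 41 / q ^ 3"
      using divide_power_add[OF qpos, of 41 8 3] by simp
    finally have 1: "41 * q ^ 8 / real k \<le> 41 / q ^ 3" .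
    have "6 * real k / q ^ 20 * (41 * q ^ 8 / real k) = 246 * q ^ 8 / q ^ 20" using kpos by simp
    also have "\<dots> = 246 / q ^ 12"
      using divide_power_add[OF qpos, of 246 8 12] by simp
    also have "\<dots> \<le> 246 / q ^ 3" using qmono[of 3 12] qpos by (intro divide_left_mono) auto
    finally have 2: "6 * real k / q ^ 20 * (41 * q ^ 8 / real k) \<le> 246 / q ^ 3" .
    have "(1 + 6 * real k / q ^ 20) * (41 * q ^ 8 / real k)
        = 41 * q ^ 8 / real k + 6 * real k / q ^ 20 * (41 * q ^ 8 / real k)"
      by (simp only: distrib_right mult_1_left)
    also have "\<dots> \<le> 41 / q ^ 3 + 246 / q ^ 3" using 1 2 by (rule add_mono)
    also have "\<dots> \<le> 300 / q ^ 3" using qpos by (simp add: add_divide_distrib[symmetric] divide_right_mono)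
    finally show "(1 + 6 * real k / q ^ 20) * (41 * q ^ 8 / real k) \<le> 300 / q ^ 3" .
  qed (use qpos kpos k in auto)
  finally show ?thesis using qpos by (simp add: mult.assoc)
qed

section \<open>From the condition number to one row\<close>

lemma euclid_norm_mult_mat_vec_le:
  assumes N: "N \<in> carrier_mat n n" and n: "n \<ge> 1"
    and c: "\<And>i j. i < n \<Longrightarrow> j < n \<Longrightarrow> \<bar>N $$ (i, j)\<bar> \<le> c"
    and x: "x \<in> carrier_vec n" "euclid_norm x = 1"
  shows "euclid_norm (N *\<^sub>v x) \<le> (real n)\<^sup>2 * c"
proof -
  have c0: "0 \<le> c" using c[of 0 0] n by simp
  have x1: "\<bar>x $ j\<bar> \<le> 1" if j: "j < n" for j
  proof -
    have "(\<Sum>i<n. (x $ i)\<^sup>2) = 1" using x by (simp add: euclid_norm_altdef)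
    moreover have "(x $ j)\<^sup>2 \<le> (\<Sum>i<n. (x $ i)\<^sup>2)" using j by (intro member_le_sum) auto
    ultimately show ?thesis by (simp add: abs_square_le_1)
  qed
  have row: "\<bar>(N *\<^sub>v x) $ i\<bar> \<le> real n * c" if i: "i < n" for i
  proof -
    have "(N *\<^sub>v x) $ i = (\<Sum>j<n. N $$ (i, j) * x $ j)"
      using N x i by (simp add: scalar_prod_def lessThan_atLeast0)
    also have "\<bar>\<dots>\<bar> \<le> (\<Sum>j<n. \<bar>N $$ (i, j) * x $ j\<bar>)" by (rule sum_abs)
    also have "\<dots> \<le> (\<Sum>j<n. c * 1)"
      unfolding abs_mult using c[OF i] x1 c0 by (intro sum_mono mult_mono) auto
    finally show ?thesis by simp
  qed
  have "(\<Sum>i<n. ((N *\<^sub>v x) $ i)\<^sup>2) \<le> (\<Sum>i<n. (real n * c)\<^sup>2)"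
    using row c0 by (intro sum_mono abs_le_square_iff[THEN iffD1]) auto
  also have "\<dots> = real n * (real n * c)\<^sup>2" by simp
  also have "\<dots> \<le> real n * (real n * (real n * c)\<^sup>2)"
    using n by (intro mult_left_mono) (auto simp: mult_le_cancel_right1)
  also have "\<dots> = ((real n)\<^sup>2 * c)\<^sup>2" by (simp add: power2_eq_square)
  finally have "sqrt (\<Sum>i<n. ((N *\<^sub>v x) $ i)\<^sup>2) \<le> sqrt (((real n)\<^sup>2 * c)\<^sup>2)"
    by (rule real_sqrt_le_mono)
  moreover have "euclid_norm (N *\<^sub>v x) = sqrt (\<Sum>i<n. ((N *\<^sub>v x) $ i)\<^sup>2)"
    using N by (simp add: euclid_norm_altdef)
  ultimately have "euclid_norm (N *\<^sub>v x) \<le> sqrt (((real n)\<^sup>2 * c)\<^sup>2)" by simp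
  then show ?thesis using c0 by simp
qed

lemma sigma1_bounds:
  assumes N: "N \<in> carrier_mat n n" and n: "n \<ge> 1"
    and c: "\<And>i j. i < n \<Longrightarrow> j < n \<Longrightarrow> \<bar>N $$ (i, j)\<bar> \<le> c"
  shows "0 \<le> sigma1 N" "sigma1 N \<le> (real n)\<^sup>2 * c"
proof -
  let ?S = "{x \<in> carrier_vec (dim_col N). euclid_norm x = 1}"
  have le: "euclid_norm (N *\<^sub>v x) \<le> (real n)\<^sup>2 * c" if "x \<in> ?S" for x
    using that N by (intro euclid_norm_mult_mat_vec_le[OF N n c]) auto
  have "euclid_norm (unit_vec n 0) = 1" using n
    by (simp add: euclid_norm_def)
  then have e: "unit_vec n 0 \<in> ?S" using N by auto
  show "sigma1 N \<le> (real n)\<^sup>2 * c" unfolding sigma1_def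
    using e le by (intro cSUP_least) auto
  have "0 \<le> euclid_norm (N *\<^sub>v unit_vec n 0)"
    by (simp add: euclid_norm_altdef sum_nonneg)
  also have "\<dots> \<le> sigma1 N" unfolding sigma1_def
    using e le by (intro cSUP_upper bdd_aboveI2) auto
  finally show "0 \<le> sigma1 N" .
qed

text \<open>
  If \<open>N\<close> is the inverse of \<open>M\<close>, then row \<open>r\<close> of \<open>N\<close> combines the rows of \<open>M\<close> to the unit vector
  \<open>e\<^sub>r\<close>. Taking the scalar product with \<open>v\<close> kills all rows but row \<open>i\<close> and leaves
  \<open>N\<^sub>r\<^sub>i (R\<^sub>i \<bullet> v) = v\<^sub>r\<close>. So the index \<open>i\<close> is the column of an entry of \<open>N\<close> of size at least \<open>T\<close>, which
  exists because both factors of the condition number are at most \<open>n\<^sup>2\<close> times the largest entry. For a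
  singular \<open>M\<close>, a linear dependence between the rows plays the role of row \<open>r\<close>.
\<close>

lemma large_condition_number_imp_row_near_span:
  fixes R :: "nat \<Rightarrow> nat \<Rightarrow> real"
  assumes n: "n \<ge> 1" and R: "\<And>i j. \<bar>R i j\<bar> \<le> 1" and T: "T > 0"
    and cond: "condition_number (mat n n (\<lambda>(i, j). R i j)) \<ge> ereal ((real n) ^ 4 * T)"
  shows "\<exists>i<n. \<forall>v. sqnorm n v = 1 \<longrightarrow> (\<forall>j<n. j \<noteq> i \<longrightarrow> dot n (R j) v = 0) \<longrightarrow> \<bar>dot n (R i) v\<bar> \<le> 1 / T"
proof -
  define M where "M = mat n n (\<lambda>(i, j). R i j)"
  have M: "M \<in> carrier_mat n n" by (simp add: M_def)
  show ?thesis
  proof (cases "invertible_mat M")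
    case False
    have "Determinant.det M = 0"
    proof (rule ccontr)
      assume "Determinant.det M \<noteq> 0"
      then have "M \<in> Units (ring_mat TYPE(real) n ())" by (rule det_non_zero_imp_unit[OF M])
      then obtain B where "B \<in> carrier_mat n n" "M * B = 1\<^sub>m n" "B * M = 1\<^sub>m n"
        by (auto simp: Units_def ring_mat_def)
      then have "invertible_mat M" using M by (auto simp: invertible_mat_def inverts_mat_def intro!: exI[of _ B])
      with False show False by blast
    qed
    then have "Determinant.det (transpose_mat M) = 0"
      using M by (simp add: Determinant.det_transpose)
    then obtain y where y: "y \<in> carrier_vec n" "y \<noteq> 0\<^sub>v n" "transpose_mat M *\<^sub>v y = 0\<^sub>v n"
      using M det_0_iff_vec_prod_zero[of "transpose_mat M" n] by auto
    obtain i where i: "i < n" "y $ i \<noteq> 0"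
      using y(1,2) by (metis carrier_vecD eq_vecI index_zero_vec(1) index_zero_vec(2))
    have comb: "(\<Sum>k<n. y $ k * R k j) = 0" if j: "j < n" for j
    proof -
      have "(transpose_mat M *\<^sub>v y) $ j = (\<Sum>k<n. R k j * y $ k)"
        using y(1) j by (simp add: M_def scalar_prod_def lessThan_atLeast0)
      then show ?thesis using y(3) j by (simp add: mult.commute)
    qed
    show ?thesis
    proof (intro exI[of _ i] conjI allI impI i(1))
      fix v assume v: "\<forall>j<n. j \<noteq> i \<longrightarrow> dot n (R j) v = 0"
      have "(\<Sum>k<n. y $ k * dot n (R k) v) = (\<Sum>j<n. (\<Sum>k<n. y $ k * R k j) * v j)"
        unfolding dot_def sum_distrib_left sum_distrib_right
        by (subst sum.swap) (simp add: mult_ac)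
      also have "\<dots> = 0" using comb by simp
      finally have "y $ i * dot n (R i) v = 0"
        using v i by (simp add: sum.remove[of "{..<n}" i])
      then show "\<bar>dot n (R i) v\<bar> \<le> 1 / T" using i T by simp
    qed
  next
    case True
    define N where "N = the (mat_inverse M)"
    note inv = mat_inverse_invertible[OF M True, folded N_def]
    have "\<exists>i<n. \<exists>j<n. T \<le> \<bar>N $$ (i, j)\<bar>"
    proof (rule ccontr)
      assume neg: "\<not> ?thesis"
      define c where "c = Max ((\<lambda>(i, j). \<bar>N $$ (i, j)\<bar>) ` ({..<n} \<times> {..<n}))"
      have fin: "finite ((\<lambda>(i, j). \<bar>N $$ (i, j)\<bar>) ` ({..<n} \<times> {..<n}))" by simp
      have ne: "(\<lambda>(i, j). \<bar>N $$ (i, j)\<bar>) ` ({..<n} \<times> {..<n}) \<noteq> {}" using n by (auto simp: lessThan_empty_iff)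
      have le: "\<bar>N $$ (i, j)\<bar> \<le> c" if "i < n" "j < n" for i j
        unfolding c_def by (rule Max_ge[OF fin]) (use that in force)
      have "c \<in> (\<lambda>(i, j). \<bar>N $$ (i, j)\<bar>) ` ({..<n} \<times> {..<n})"
        unfolding c_def by (rule Max_in[OF fin ne])
      then have cT: "c < T" using neg by (auto simp: not_le)
      have M1: "\<bar>M $$ (i, j)\<bar> \<le> 1" if "i < n" "j < n" for i j
        using R that by (simp add: M_def)
      have "sigma1 M * sigma1 N \<le> ((real n)\<^sup>2 * 1) * ((real n)\<^sup>2 * c)"
        by (rule mult_mono) (use sigma1_bounds[OF M n M1] sigma1_bounds[OF inv(1) n le] in auto)
      also have "\<dots> = real n ^ 4 * c" by (simp add: power2_eq_square power4_eq_xxxx)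
      also have "\<dots> < real n ^ 4 * T" using cT n by simp
      finally have "condition_number M < ereal (real n ^ 4 * T)"
        using True by (simp add: condition_number_def N_def)
      then show False using cond by (simp add: M_def)
    qed
    then obtain r i where ri: "r < n" "i < n" "T \<le> \<bar>N $$ (r, i)\<bar>" by blast
    have comb: "(\<Sum>k<n. N $$ (r, k) * R k j) = (if j = r then 1 else 0)" if j: "j < n" for j
    proof -
      have "(N * M) $$ (r, j) = (\<Sum>k<n. N $$ (r, k) * R k j)"
        using inv(1) ri j by (simp add: M_def scalar_prod_def lessThan_atLeast0)
      then show ?thesis using inv(3) ri j by auto
    qed
    show ?thesis
    proof (intro exI[of _ i] conjI allI impI ri(2))
      fix v assume u: "sqnorm n v = 1" and v: "\<forall>j<n. j \<noteq> i \<longrightarrow> dot n (R j) v = 0"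
      have "(\<Sum>k<n. N $$ (r, k) * dot n (R k) v) = (\<Sum>j<n. (\<Sum>k<n. N $$ (r, k) * R k j) * v j)"
        unfolding dot_def sum_distrib_left sum_distrib_right
        by (subst sum.swap) (simp add: mult_ac)
      also have "\<dots> = (\<Sum>j<n. (if j = r then 1 else 0) * v j)"
        using comb by simp
      also have "\<dots> = v r" using ri by (simp add: if_distrib[of "\<lambda>x. x * _"] cong: if_cong)
      finally have eq: "N $$ (r, i) * dot n (R i) v = v r"
        using v ri by (simp add: sum.remove[of "{..<n}" i])
      have "T * \<bar>dot n (R i) v\<bar> \<le> \<bar>N $$ (r, i)\<bar> * \<bar>dot n (R i) v\<bar>"
        using ri by (intro mult_right_mono) auto
      also have "\<dots> = \<bar>v r\<bar>" using eq by (metis abs_mult)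
      also have "\<dots> \<le> 1" using u member_le_sum[of r "{..<n}" "\<lambda>j. (v j)\<^sup>2"] ri
        by (simp add: sqnorm_def abs_square_le_1)
      finally show "\<bar>dot n (R i) v\<bar> \<le> 1 / T" using T by (simp add: pos_le_divide_eq mult.commute)
    qed
  qed
qed

lemma ex_unit_normal:
  fixes R :: "nat \<Rightarrow> nat \<Rightarrow> real"
  assumes i: "i < n"
  shows "\<exists>v. sqnorm n v = 1 \<and> (\<forall>j<n. j \<noteq> i \<longrightarrow> dot n (R j) v = 0)"
proof -
  define M where "M = mat n n (\<lambda>(j, k). if j = i then 0 else R j k)"
  have M: "M \<in> carrier_mat n n" by (simp add: M_def)
  \<comment> \<open>row \<open>i\<close> of \<open>M\<close> is 0, so \<open>M\<close> is singular and has a nonzero kernel vector\<close>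
  have "transpose_mat M *\<^sub>v unit_vec n i = 0\<^sub>v n"
    using i by (intro eq_vecI) (auto simp: M_def scalar_prod_def unit_vec_def if_distrib cong: if_cong)
  moreover have "unit_vec n i \<noteq> (0\<^sub>v n :: real vec)" using i
    by (metis index_unit_vec(1) index_zero_vec(1) zero_neq_one)
  ultimately have "Determinant.det (transpose_mat M) = 0"
    using M det_0_iff_vec_prod_zero[of "transpose_mat M" n] by (metis transpose_carrier_mat unit_vec_carrier)
  then have "Determinant.det M = 0" using M by (simp add: Determinant.det_transpose)
  then obtain y where y: "y \<in> carrier_vec n" "y \<noteq> 0\<^sub>v n" "M *\<^sub>v y = 0\<^sub>v n"
    using M det_0_iff_vec_prod_zero[of M n] by auto
  have pos: "sqnorm n (($) y) > 0"
  proof -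
    obtain k where "k < n" "y $ k \<noteq> 0"
      using y(1,2) by (metis carrier_vecD eq_vecI index_zero_vec(1) index_zero_vec(2))
    then show ?thesis unfolding sqnorm_def by (intro sum_pos2[of _ k]) auto
  qed
  have orth: "dot n (R j) (($) y) = 0" if j: "j < n" "j \<noteq> i" for j
  proof -
    have "(M *\<^sub>v y) $ j = dot n (R j) (($) y)"
      using y(1) j by (simp add: M_def scalar_prod_def dot_def lessThan_atLeast0)
    then show ?thesis using y(3) j by simp
  qed
  show ?thesis
  proof (intro exI[of _ "\<lambda>k. (1 / sqrt (sqnorm n (($) y))) * y $ k"] conjI allI impI)
    show "sqnorm n (\<lambda>k. (1 / sqrt (sqnorm n (($) y))) * y $ k) = 1"
      unfolding sqnorm_scale using pos by (simp add: power_divide)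
    show "dot n (R j) (\<lambda>k. (1 / sqrt (sqnorm n (($) y))) * y $ k) = 0" if "j < n" "j \<noteq> i" for j
      unfolding dot_scale using orth[OF that] by simp
  qed
qed

text \<open>
  Choosing the normal by a fixed rule makes it a function of the rows other than \<open>i\<close>, hence
  independent of row \<open>i\<close>.
\<close>

definition normal_to_others :: "nat \<Rightarrow> nat \<Rightarrow> (nat \<Rightarrow> nat \<Rightarrow> real) \<Rightarrow> nat \<Rightarrow> real" where
  "normal_to_others n i R = (SOME v. sqnorm n v = 1 \<and> (\<forall>j<n. j \<noteq> i \<longrightarrow> dot n (R j) v = 0))"

lemma normal_to_others:
  assumes "i < n"
  shows "sqnorm n (normal_to_others n i R) = 1"
    and "\<And>j. j < n \<Longrightarrow> j \<noteq> i \<Longrightarrow> dot n (R j) (normal_to_others n i R) = 0"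
  using someI_ex[OF ex_unit_normal[OF assms, of R]] unfolding normal_to_others_def by blast+

lemma normal_to_others_upd: "normal_to_others n i (R(i := x)) = normal_to_others n i R"
  unfolding normal_to_others_def by (intro arg_cong[where f = Eps] ext) auto

text \<open>
  Sampling row \<open>i\<close> last, one may treat the chosen normal as a constant vector and apply the
  assumption \<open>good\<close> to it.
\<close>

lemma prob_row_near_normal:
  assumes i: "i < n" and r: "0 \<le> r"
    and good: "\<And>v. sqnorm n v = 1 \<Longrightarrow> G v \<Longrightarrow> measure_pmf.prob (row_pmf n \<mu>) {x. \<bar>dot n x v\<bar> \<le> \<delta>} \<le> r"
  shows "measure_pmf.prob (rows_pmf n \<mu>)
    {R. \<bar>dot n (R i) (normal_to_others n i R)\<bar> \<le> \<delta> \<and> G (normal_to_others n i R)} \<le> r"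
proof -
  let ?Q = "Pi_pmf ({..<n} - {i}) (\<lambda>_. 0) (\<lambda>_. row_pmf n \<mu>)"
  let ?S = "{R. \<bar>dot n (R i) (normal_to_others n i R)\<bar> \<le> \<delta> \<and> G (normal_to_others n i R)}"
  have "{..<n} = insert i ({..<n} - {i})" using i by auto
  then have "rows_pmf n \<mu> = map_pmf (\<lambda>(x, R). R(i := x)) (pair_pmf (row_pmf n \<mu>) ?Q)"
    unfolding rows_pmf_def by (metis Diff_insert_absorb Pi_pmf_insert finite_Diff finite_lessThan insertI1 mk_disjoint_insert)
  also have "\<dots> = bind_pmf ?Q (\<lambda>R. map_pmf (\<lambda>x. R(i := x)) (row_pmf n \<mu>))"
    by (subst pair_commute_pmf) (simp add: pair_pmf_def map_bind_pmf map_pmf_def bind_assoc_pmf bind_return_pmf)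
  finally have eq: "rows_pmf n \<mu> = \<dots>" .
  have "emeasure (measure_pmf (rows_pmf n \<mu>)) ?S
      = (\<integral>\<^sup>+R. emeasure (measure_pmf (map_pmf (\<lambda>x. R(i := x)) (row_pmf n \<mu>))) ?S \<partial>measure_pmf ?Q)"
    unfolding eq emeasure_bind_pmf ..
  also have "\<dots> \<le> (\<integral>\<^sup>+R. ennreal r \<partial>measure_pmf ?Q)"
  proof (intro nn_integral_mono)
    fix R
    define v where "v = normal_to_others n i R"
    have vimage: "(\<lambda>x. R(i := x)) -` ?S = {x. \<bar>dot n x v\<bar> \<le> \<delta> \<and> G v}"
      by (auto simp: normal_to_others_upd v_def)
    have "measure_pmf.prob (row_pmf n \<mu>) {x. \<bar>dot n x v\<bar> \<le> \<delta> \<and> G v} \<le> r"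
      using good[of v] normal_to_others(1)[OF i, of R] r by (cases "G v") (auto simp: v_def)
    then show "emeasure (measure_pmf (map_pmf (\<lambda>x. R(i := x)) (row_pmf n \<mu>))) ?S \<le> ennreal r"
      unfolding emeasure_map_pmf vimage by (simp add: measure_pmf.emeasure_eq_measure ennreal_leI)
  qed
  also have "\<dots> = ennreal r" by simp
  finally show ?thesis using r by (simp add: measure_pmf.emeasure_eq_measure)
qed

section \<open>Structured normals are unlikely\<close>

text \<open>
  Some multiple of \<open>v\<close> that is neither too small to be informative (every small multiple of a
  spread vector is near the origin) nor too large is within \<open>q\<close> of the integer lattice.
\<close>

definition structured :: "nat \<Rightarrow> real \<Rightarrow> nat \<Rightarrow> (nat \<Rightarrow> real) \<Rightarrow> bool" where
  "structured n q K v \<longleftrightarrow> (\<exists>k. q ^ 4 \<le> real k \<and> k \<le> K \<and> lattice_sqdist n (\<lambda>j. real k * v j) \<le> q\<^sup>2)"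

text \<open>
  The following three quantities bound, in this order, the probability of a large operator norm,
  and, for a given \<open>k\<close> in the small and in the large regime, that of a normal for which this \<open>k\<close>
  is the least one.
\<close>

definition norm_term :: "nat \<Rightarrow> real \<Rightarrow> real" where
  "norm_term n q = (2 * (real n)\<^sup>2 + 1) ^ (2 * n) * exp (- (q ^ 21 - 1)\<^sup>2 / 18)"

definition small_scale_term :: "nat \<Rightarrow> real \<Rightarrow> real \<Rightarrow> real \<Rightarrow> real" where
  "small_scale_term n q c p =
     exp (4 * q ^ 24 + 3 * q ^ 39 + 4 * q ^ 38) * (p + exp (- (c\<^sup>2 * q\<^sup>2))) ^ (n - 1)"

definition large_scale_term :: "nat \<Rightarrow> real \<Rightarrow> real \<Rightarrow> real" where
  "large_scale_term n q K = exp (q ^ 40 + 36 * q ^ 38) * (1 + 6 * K) * (300 / q ^ 3) ^ (n - 1)"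

text \<open>
  Splitting according to the least \<open>k\<close> turns the existence of a structured normal into the
  events of the two regimes. The event of a large operator norm is split off beforehand, so that
  its probability is not multiplied by the number of possible \<open>k\<close>.
\<close>

lemma prob_structured_normal_le:
  fixes n K :: nat and q c p :: real
  assumes \<mu>: "0 \<le> \<mu>" "\<mu> \<le> 1"
    and q: "q \<ge> 2" "q ^ 40 = real n" and J: "J \<subseteq> {..<n}" "card J = n - 1"
    and K: "5 * exp (- (\<mu> / 2) * q\<^sup>2) \<le> q ^ 8 / real K"
    and c: "c > 0" and p0: "p \<ge> 0"
    and p: "\<And>v. sqnorm n v = 1 \<Longrightarrow> measure_pmf.prob (row_pmf n \<mu>) {x. \<bar>dot n x v\<bar> \<le> c} \<le> p"
  shows "measure_pmf.prob (rows_pmf n \<mu>)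
      {R. \<exists>v. sqnorm n v = 1 \<and> structured n q K v \<and> (\<forall>i\<in>J. dot n (R i) v = 0)}
    \<le> norm_term n q + real (K + 1) * (small_scale_term n q c p + large_scale_term n q (real K))"
proof -
  let ?P = "measure_pmf.prob (rows_pmf n \<mu>)"
  let ?E = "{R. \<exists>v. sqnorm n v = 1 \<and> structured n q K v \<and> (\<forall>i\<in>J. dot n (R i) v = 0)}"
  let ?O = "{R. \<exists>d. (q ^ 21)\<^sup>2 * sqnorm n d < (\<Sum>i<n. (dot n (R i) d)\<^sup>2)}"
  define V where "V = (\<lambda>k. {v. q ^ 4 \<le> real k \<and> sqnorm n v = 1 \<and> lattice_sqdist n (\<lambda>j. real k * v j) \<le> q\<^sup>2
    \<and> (\<forall>k'. q ^ 4 \<le> real k' \<longrightarrow> k' < k \<longrightarrow> q\<^sup>2 \<le> lattice_sqdist n (\<lambda>j. real k' * v j))})"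
  define E where "E = (\<lambda>k. {R. \<exists>v\<in>V k. \<forall>i\<in>J. dot n (R i) v = 0})"
  have n: "n \<ge> 1" using q by (cases n) auto
  have q21: "1 \<le> q ^ 21" using q by (intro one_le_power) auto
  have nonneg: "0 \<le> small_scale_term n q c p" "0 \<le> large_scale_term n q (real K)"
    using p0 q by (auto simp: small_scale_term_def large_scale_term_def)
  have "?E \<subseteq> ?O \<union> (\<Union>k\<in>{..K}. E k - ?O)"
  proof
    fix R assume "R \<in> ?E"
    then obtain v where v: "sqnorm n v = 1" "structured n q K v" "\<forall>i\<in>J. dot n (R i) v = 0" by blast
    define k where "k = (LEAST k. q ^ 4 \<le> real k \<and> lattice_sqdist n (\<lambda>j. real k * v j) \<le> q\<^sup>2)"
    obtain k0 where k0: "q ^ 4 \<le> real k0" "k0 \<le> K" "lattice_sqdist n (\<lambda>j. real k0 * v j) \<le> q\<^sup>2"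
      using v(2) unfolding structured_def by blast
    have k: "q ^ 4 \<le> real k" "lattice_sqdist n (\<lambda>j. real k * v j) \<le> q\<^sup>2"
      using LeastI[of "\<lambda>k. q ^ 4 \<le> real k \<and> lattice_sqdist n (\<lambda>j. real k * v j) \<le> q\<^sup>2" k0] k0
      unfolding k_def by blast+
    have "k \<le> k0" unfolding k_def by (rule Least_le) (use k0 in blast)
    moreover have "q\<^sup>2 \<le> lattice_sqdist n (\<lambda>j. real k' * v j)" if "q ^ 4 \<le> real k'" "k' < k" for k'
    proof -
      have "\<not> (q ^ 4 \<le> real k' \<and> lattice_sqdist n (\<lambda>j. real k' * v j) \<le> q\<^sup>2)"
        using that(2) unfolding k_def by (rule not_less_Least)
      then show ?thesis using that(1) by simp
    qed
    ultimately have "v \<in> V k" "k \<le> K" using k v k0 by (auto simp: V_def)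
    then have "R \<in> (\<Union>k\<in>{..K}. E k)" using v(3) by (auto simp: E_def)
    then show "R \<in> ?O \<union> (\<Union>k\<in>{..K}. E k - ?O)" by blast
  qed
  then have "?P ?E \<le> ?P (?O \<union> (\<Union>k\<in>{..K}. E k - ?O))"
    by (intro measure_pmf.finite_measure_mono) auto
  also have "\<dots> \<le> ?P ?O + ?P (\<Union>k\<in>{..K}. E k - ?O)"
    by (intro measure_Un_le) auto
  also have "?P (\<Union>k\<in>{..K}. E k - ?O) \<le> (\<Sum>k\<in>{..K}. ?P (E k - ?O))"
    by (intro measure_pmf.finite_measure_subadditive_finite) auto
  also have "\<dots> \<le> (\<Sum>k\<in>{..K}. small_scale_term n q c p + large_scale_term n q (real K))"
  proof (intro sum_mono)
    fix k assume k: "k \<in> {..K}"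
    consider "real k < q ^ 4" | "q ^ 4 \<le> real k" "real k \<le> q ^ 11" | "q ^ 11 \<le> real k" by linarith
    then show "?P (E k - ?O) \<le> small_scale_term n q c p + large_scale_term n q (real K)"
    proof cases
      case 1
      then have "V k = {}" by (auto simp: V_def)
      then show ?thesis using nonneg by (simp add: E_def)
    next
      case 2
      have "?P (E k - ?O) \<le> small_scale_term n q c p"
        unfolding E_def small_scale_term_def
        by (rule orthogonal_small_scale[OF _ q(2) J 2 c p0 p]) (use q in \<open>auto simp: V_def\<close>)
      then show ?thesis using nonneg by simp
    next
      case 3
      have kK: "real k \<le> real K" using k by simp
      have "?P (E k - ?O) \<le> large_scale_term n q (real K)"
        unfolding E_def large_scale_term_def
        by (rule orthogonal_large_scale[OF \<mu> q J 3 kK K]) (auto simp: V_def)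
      then show ?thesis using nonneg by simp
    qed
  qed
  also have "\<dots> = real (K + 1) * (small_scale_term n q c p + large_scale_term n q (real K))" by simp
  also have "?P ?O \<le> norm_term n q"
    unfolding norm_term_def by (rule prob_norm_large_le[OF \<mu> n q21])
  finally show ?thesis by simp
qed

text \<open>
  The union bound over the row \<open>i\<close> that nearly lies in the span of the others: the chosen
  normal of the others is either structured or has a small ball probability of order \<open>q ^ 4 / K\<close>.
\<close>

lemma prob_large_condition_number_le:
  fixes n K :: nat and q c p :: real
  assumes \<mu>: "0 \<le> \<mu>" "\<mu> \<le> 1"
    and q: "q \<ge> 2" "q ^ 40 = real n" and K0: "K > 0"
    and K: "5 * exp (- (\<mu> / 2) * q\<^sup>2) \<le> q ^ 8 / real K"
    and c: "c > 0" and p0: "p \<ge> 0"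
    and p: "\<And>v. sqnorm n v = 1 \<Longrightarrow> measure_pmf.prob (row_pmf n \<mu>) {x. \<bar>dot n x v\<bar> \<le> c} \<le> p"
  shows "measure_pmf.prob (random_mat n \<mu>)
      {M. condition_number M \<ge> ereal (real n ^ 4 * (3 * real (K + 1)))}
    \<le> real n * (norm_term n q + real (K + 1) * (small_scale_term n q c p + large_scale_term n q (real K))
         + 4 * (5 * q ^ 4 / real K + exp (- (\<mu> / 2) * q\<^sup>2)))"
    (is "_ \<le> real n * (?s + ?r)")
proof -
  let ?P = "measure_pmf.prob (rows_pmf n \<mu>)"
  define T where "T = 3 * real (K + 1)"
  have T: "T > 0" by (simp add: T_def)
  have n: "n \<ge> 1" using q by (cases n) auto
  have q4: "1 \<le> q ^ 4" using q by (intro one_le_power) auto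
  define W where "W = normal_to_others n"
  define C where "C = {R. condition_number (mat n n (\<lambda>(i, j). R i j)) \<ge> ereal (real n ^ 4 * T)}"
  define D where "D = (\<lambda>i. {R. \<exists>v. sqnorm n v = 1 \<and> structured n q K v \<and> (\<forall>j\<in>{..<n} - {i}. dot n (R j) v = 0)})"
  define F where "F = (\<lambda>i. {R. \<bar>dot n (R i) (W i R)\<bar> \<le> 1 / T \<and> \<not> structured n q K (W i R)})"
  have r0: "0 \<le> ?r" using q4 by simp
  have sub: "C \<inter> set_pmf (rows_pmf n \<mu>) \<subseteq> (\<Union>i\<in>{..<n}. D i \<union> F i)"
  proof
    fix R assume R: "R \<in> C \<inter> set_pmf (rows_pmf n \<mu>)"
    have "\<bar>R i j\<bar> \<le> 1" for i j using R abs_rows_pmf_le_1 by blast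
    moreover have "condition_number (mat n n (\<lambda>(i, j). R i j)) \<ge> ereal (real n ^ 4 * T)"
      using R by (simp add: C_def)
    ultimately have "\<exists>i<n. \<forall>v. sqnorm n v = 1 \<longrightarrow> (\<forall>j<n. j \<noteq> i \<longrightarrow> dot n (R j) v = 0) \<longrightarrow> \<bar>dot n (R i) v\<bar> \<le> 1 / T"
      by (rule large_condition_number_imp_row_near_span[OF n _ T])
    then obtain i where i: "i < n" and
      near: "\<And>v. sqnorm n v = 1 \<Longrightarrow> (\<forall>j<n. j \<noteq> i \<longrightarrow> dot n (R j) v = 0) \<Longrightarrow> \<bar>dot n (R i) v\<bar> \<le> 1 / T"
      by blast
    note W = normal_to_others[where R = R, OF i, folded W_def]
    have "\<bar>dot n (R i) (W i R)\<bar> \<le> 1 / T" by (rule near) (use W in auto)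
    moreover have "R \<in> D i" if "structured n q K (W i R)"
      unfolding D_def mem_Collect_eq using W that by (intro exI[of _ "W i R"]) auto
    ultimately have "R \<in> D i \<union> F i" by (auto simp: F_def)
    with i show "R \<in> (\<Union>i\<in>{..<n}. D i \<union> F i)" by blast
  qed
  have D: "?P (D i) \<le> ?s" if i: "i < n" for i
    unfolding D_def using i by (intro prob_structured_normal_le \<mu> q K c p0 p) auto
  have F: "?P (F i) \<le> ?r" if i: "i < n" for i
    unfolding F_def W_def
  proof (rule prob_row_near_normal[OF i r0])
    fix v assume v: "\<not> structured n q K v"
    define \<kappa> where "\<kappa> = nat \<lceil>q ^ 4\<rceil>"
    have \<kappa>: "q ^ 4 \<le> real \<kappa>" "real \<kappa> \<le> q ^ 4 + 1"
      using q4 by (auto simp: \<kappa>_def)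
    have "measure_pmf.prob (row_pmf n \<mu>) {x. \<bar>dot n x v\<bar> \<le> 1 / T}
        \<le> 4 * ((2 * real \<kappa> + 1) / real (K + 1) + exp (- (\<mu> / 2) * q\<^sup>2))"
      unfolding T_def
    proof (rule small_ball[OF \<mu>])
      fix k assume k: "\<kappa> \<le> k" "k < K + 1"
      then have "q ^ 4 \<le> real k" using \<kappa> by linarith
      moreover have "k \<le> K" using k by simp
      ultimately have "\<not> lattice_sqdist n (\<lambda>j. real k * v j) \<le> q\<^sup>2"
        using v unfolding structured_def by blast
      then show "q\<^sup>2 \<le> lattice_sqdist n (\<lambda>j. real k * v j)" by simp
    qed simp
    also have "\<dots> \<le> ?r"
    proof -
      have "(2 * real \<kappa> + 1) / real (K + 1) \<le> 5 * q ^ 4 / real K"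
        using \<kappa> q4 K0 by (intro frac_le) auto
      then show ?thesis by (intro mult_left_mono add_right_mono) simp_all
    qed
    finally show "measure_pmf.prob (row_pmf n \<mu>) {x. \<bar>dot n x v\<bar> \<le> 1 / T} \<le> ?r" .
  qed
  have "measure_pmf.prob (random_mat n \<mu>) {M. condition_number M \<ge> ereal (real n ^ 4 * T)} = ?P C"
    by (simp add: random_mat_rows C_def vimage_def)
  also have "\<dots> = ?P (C \<inter> set_pmf (rows_pmf n \<mu>))" by (simp add: measure_Int_set_pmf)
  also have "\<dots> \<le> ?P (\<Union>i\<in>{..<n}. D i \<union> F i)"
    using sub by (intro measure_pmf.finite_measure_mono) auto
  also have "\<dots> \<le> (\<Sum>i<n. ?P (D i \<union> F i))"
    by (intro measure_pmf.finite_measure_subadditive_finite) auto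
  also have "\<dots> \<le> (\<Sum>i<n. ?s + ?r)"
  proof (intro sum_mono)
    fix i assume "i \<in> {..<n}"
    then have i: "i < n" by simp
    have "?P (D i \<union> F i) \<le> ?P (D i) + ?P (F i)"
      by (intro measure_Un_le) auto
    also have "\<dots> \<le> ?s + ?r" using D[OF i] F[OF i] by (rule add_mono)
    finally show "?P (D i \<union> F i) \<le> ?s + ?r" .
  qed
  also have "\<dots> = real n * (?s + ?r)" by simp
  finally show ?thesis unfolding T_def .
qed

section \<open>Asymptotics\<close>

text \<open>
  All terms but one are superpolynomially small. The exception, of order \<open>n q ^ 4 / K\<close>, is what makes
  \<open>K\<close> a large power of \<open>n\<close> depending on \<open>A\<close>; the exponent \<open>A + 4\<close> is more than enough.
\<close>

lemma eventually_bound_le_powr: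
  fixes A \<mu> c p :: real
  assumes A: "A > 0" and \<mu>: "\<mu> > 0" and c: "c > 0" and p: "0 \<le> p" "p < 1"
  shows "\<forall>\<^sub>F n in sequentially. \<forall>K::nat. real n powr (A + 4) / 2 \<le> real K \<longrightarrow> real K \<le> real n powr (A + 4) \<longrightarrow>
    (let q = real n powr (1 / 40) in
      5 * exp (- (\<mu> / 2) * q\<^sup>2) \<le> q ^ 8 / real K \<and>
      real n * (norm_term n q + real (K + 1) * (small_scale_term n q c p + large_scale_term n q (real K))
         + 4 * (5 * q ^ 4 / real K + exp (- (\<mu> / 2) * q\<^sup>2))) \<le> real n powr (- A))"
proof -
  \<comment> \<open>a bound for \<open>p + exp (- c\<^sup>2 q\<^sup>2)\<close> that is still below 1\<close>
  define r where "r = (1 + p) / 2"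
  define l where "l = - ln r"
  have r: "0 < r" "r < 1" using p by (auto simp: r_def)
  have l: "l > 0" using r by (simp add: l_def)
  have rl: "r = exp (- l)" using r by (simp add: l_def)
  have pr: "p < r" using p by (simp add: r_def)
  define Q where "Q = (\<lambda>x::real. x powr (1 / 40))"
  have e0: "\<forall>\<^sub>F x in at_top. p + exp (- (c\<^sup>2 * (Q x)\<^sup>2)) \<le> r"
  proof -
    have "((\<lambda>x. p + exp (- (c\<^sup>2 * (Q x)\<^sup>2))) \<longlongrightarrow> p) at_top"
      unfolding Q_def using c by real_asymp
    from order_tendstoD(2)[OF this pr] show ?thesis by eventually_elim simp
  qed
  have e1: "\<forall>\<^sub>F x in at_top. exp (2 * x * ln (2 * x\<^sup>2 + 1) - (Q x ^ 21 - 1)\<^sup>2 / 18) \<le> x powr (- A - 1) / 8"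
    unfolding Q_def using A by real_asymp
  have e2: "\<forall>\<^sub>F x in at_top. 2 * x powr (A + 4) *
      exp (4 * Q x ^ 24 + 3 * Q x ^ 39 + 4 * Q x ^ 38 - l * (x - 1)) \<le> x powr (- A - 1) / 8"
    unfolding Q_def using A l by real_asymp
  have e3: "\<forall>\<^sub>F x in at_top. 14 * x powr (2 * A + 8) *
      exp (Q x ^ 40 + 36 * Q x ^ 38 + ln (300 / Q x ^ 3) * (x - 1)) \<le> x powr (- A - 1) / 8"
    unfolding Q_def using A by real_asymp
  have e4: "\<forall>\<^sub>F x in at_top. 40 * Q x ^ 4 / x powr (A + 4) \<le> x powr (- A - 1) / 8"
    unfolding Q_def using A by real_asymp
  have e5: "\<forall>\<^sub>F x in at_top. 4 * exp (- (\<mu> / 2) * (Q x)\<^sup>2) \<le> x powr (- A - 1) / 8"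
    unfolding Q_def using A \<mu> by real_asymp
  have e6: "\<forall>\<^sub>F x in at_top. 5 * exp (- (\<mu> / 2) * (Q x)\<^sup>2) \<le> Q x ^ 8 / x powr (A + 4)"
    unfolding Q_def using A \<mu> by real_asymp
  have ev: "\<forall>\<^sub>F n in sequentially. P (real n)" if "\<forall>\<^sub>F x in at_top. P x" for P
    using that filterlim_real_sequentially by (rule eventually_compose_filterlim)
  show ?thesis
    using ev[OF e0] ev[OF e1] ev[OF e2] ev[OF e3] ev[OF e4] ev[OF e5] ev[OF e6] eventually_ge_at_top[of 1]
  proof eventually_elim
    case (elim n)
    define x where "x = real n"
    define q where "q = Q x"
    note b = elim(1-7)[folded x_def, folded q_def]
    have n: "1 \<le> n" by (rule elim(8))
    have q_eq: "x powr (1 / 40) = q" by (simp add: q_def Q_def)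
    show ?case unfolding Let_def x_def[symmetric] q_eq
    proof (intro allI impI)
      fix K :: nat
      assume K: "x powr (A + 4) / 2 \<le> real K" "real K \<le> x powr (A + 4)"
      have x: "x \<ge> 1" using n by (simp add: x_def)
      have q: "q > 0" using x by (simp add: q_def Q_def)
      have y1: "1 \<le> x powr (A + 4)" using x A by (intro ge_one_powr_ge_zero) auto
      have Kpos: "real K > 0" using K y1 by linarith
      have n1: "real (n - 1) = x - 1" using n by (simp add: x_def of_nat_diff)
      have "norm_term n q = exp (2 * x * ln (2 * x\<^sup>2 + 1) - (q ^ 21 - 1)\<^sup>2 / 18)"
      proof -
        have "(2 * x\<^sup>2 + 1) ^ (2 * n) = exp (ln (2 * x\<^sup>2 + 1)) ^ (2 * n)"
          by (subst exp_ln) (auto intro: add_nonneg_pos)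
        also have "\<dots> = exp (2 * x * ln (2 * x\<^sup>2 + 1))"
          by (simp add: exp_of_nat_mult[symmetric] x_def)
        finally show ?thesis by (simp add: norm_term_def x_def[symmetric] exp_add[symmetric])
      qed
      then have t1: "norm_term n q \<le> x powr (- A - 1) / 8" using b by simp
      have K1: "real (K + 1) \<le> 2 * x powr (A + 4)" using K y1 by simp
      have "small_scale_term n q c p \<le> exp (4 * q ^ 24 + 3 * q ^ 39 + 4 * q ^ 38) * r ^ (n - 1)"
        unfolding small_scale_term_def using b(1) p by (intro mult_left_mono power_mono) auto
      also have "r ^ (n - 1) = exp (- l * (x - 1))"
        unfolding rl n1[symmetric] by (simp add: exp_of_nat_mult[symmetric] mult.commute)
      also have "exp (4 * q ^ 24 + 3 * q ^ 39 + 4 * q ^ 38) * \<dots>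
          = exp (4 * q ^ 24 + 3 * q ^ 39 + 4 * q ^ 38 - l * (x - 1))"
        by (simp add: exp_add[symmetric])
      finally have "real (K + 1) * small_scale_term n q c p
          \<le> 2 * x powr (A + 4) * exp (4 * q ^ 24 + 3 * q ^ 39 + 4 * q ^ 38 - l * (x - 1))"
        using K1 p by (intro mult_mono) (auto simp: small_scale_term_def)
      then have t2: "real (K + 1) * small_scale_term n q c p \<le> x powr (- A - 1) / 8" using b by linarith
      have "(300 / q ^ 3) ^ (n - 1) = exp (ln (300 / q ^ 3)) ^ (n - 1)"
        using q by (subst exp_ln) auto
      also have "\<dots> = exp (ln (300 / q ^ 3) * (x - 1))"
        unfolding n1[symmetric] by (simp add: exp_of_nat_mult[symmetric] mult.commute)
      finally have pw: "(300 / q ^ 3) ^ (n - 1) = exp (ln (300 / q ^ 3) * (x - 1))" .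
      have "large_scale_term n q (real K)
          \<le> exp (q ^ 40 + 36 * q ^ 38) * (7 * x powr (A + 4)) * exp (ln (300 / q ^ 3) * (x - 1))"
        unfolding large_scale_term_def pw using K y1 by (intro mult_right_mono mult_left_mono) auto
      then have "real (K + 1) * large_scale_term n q (real K)
          \<le> (2 * x powr (A + 4)) * (exp (q ^ 40 + 36 * q ^ 38) * (7 * x powr (A + 4)) * exp (ln (300 / q ^ 3) * (x - 1)))"
        using K1 q by (intro mult_mono) (auto simp: large_scale_term_def)
      also have "\<dots> = 14 * (x powr (A + 4) * x powr (A + 4)) * exp (q ^ 40 + 36 * q ^ 38 + ln (300 / q ^ 3) * (x - 1))"
        by (simp only: exp_add) (simp add: mult_ac)
      also have "x powr (A + 4) * x powr (A + 4) = x powr (2 * A + 8)"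
        by (simp add: powr_add[symmetric])
      finally have t3: "real (K + 1) * large_scale_term n q (real K) \<le> x powr (- A - 1) / 8" using b by linarith
      have "4 * (5 * q ^ 4 / real K) \<le> 4 * (5 * q ^ 4 / (x powr (A + 4) / 2))"
        using K y1 Kpos q by (intro mult_left_mono divide_left_mono mult_pos_pos) auto
      then have t4: "4 * (5 * q ^ 4 / real K) \<le> x powr (- A - 1) / 8" using b by simp
      have "x * (norm_term n q + real (K + 1) * (small_scale_term n q c p + large_scale_term n q (real K))
           + 4 * (5 * q ^ 4 / real K + exp (- (\<mu> / 2) * q\<^sup>2))) \<le> x * x powr (- A - 1)"
        using t1 t2 t3 t4 b(6) x powr_ge_zero[of x "- A - 1"]
        unfolding distrib_left[of "real (K + 1)"] distrib_left[of 4]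
        by (intro mult_left_mono) linarith+
      also have "x * x powr (- A - 1) = x powr (- A)"
        using x powr_add[of x 1 "- A - 1"] by simp
      finally have main: "x * (norm_term n q + real (K + 1) * (small_scale_term n q c p + large_scale_term n q (real K))
           + 4 * (5 * q ^ 4 / real K + exp (- (\<mu> / 2) * q\<^sup>2))) \<le> x powr (- A)" .
      have "q ^ 8 / x powr (A + 4) \<le> q ^ 8 / real K" using K y1 Kpos q by (intro divide_left_mono mult_pos_pos) auto
      then have "5 * exp (- (\<mu> / 2) * q\<^sup>2) \<le> q ^ 8 / real K" using b(7) by linarith
      with main show "5 * exp (- (\<mu> / 2) * q\<^sup>2) \<le> q ^ 8 / real K \<and>
        x * (norm_term n q + real (K + 1) * (small_scale_term n q c p + large_scale_term n q (real K))
           + 4 * (5 * q ^ 4 / real K + exp (- (\<mu> / 2) * q\<^sup>2))) \<le> x powr (- A)" by blast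
    qed
  qed
qed

theorem theorem3p3:
  "\<forall>A::real. A > 0 \<longrightarrow> (\<exists>B::real. B > 0 \<and>
     (\<forall>\<mu>::real. 0 < \<mu> \<and> \<mu> \<le> 1 \<longrightarrow>
       (\<exists>N::nat. \<forall>n\<ge>N.
          measure_pmf.prob (random_mat n \<mu>) {M. condition_number M \<ge> ereal (real n powr B)}
            \<le> real n powr (- A))))"
proof (intro allI impI)
  fix A :: real assume A: "A > 0"
  have "\<exists>N. \<forall>n\<ge>N. measure_pmf.prob (random_mat n \<mu>) {M. condition_number M \<ge> ereal (real n powr (A + 9))}
      \<le> real n powr (- A)" if \<mu>: "0 < \<mu> \<and> \<mu> \<le> 1" for \<mu>
  proof -
    have \<mu>01: "0 \<le> \<mu>" "\<mu> \<le> 1" "\<mu> > 0" using \<mu> by auto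
    obtain c p where c: "0 < c" and p: "p < 1" "0 \<le> p"
      and crude: "\<And>n v. sqnorm n v = 1 \<Longrightarrow> measure_pmf.prob (row_pmf n \<mu>) {x. \<bar>dot n x v\<bar> \<le> c} \<le> p"
      using crude_small_ball[OF \<mu>01(3,2)] by metis
    have q2: "\<forall>\<^sub>F n::nat in sequentially. 2 \<le> real n powr (1 / 40)" by real_asymp
    have "\<forall>\<^sub>F n in sequentially. measure_pmf.prob (random_mat n \<mu>)
        {M. condition_number M \<ge> ereal (real n powr (A + 9))} \<le> real n powr (- A)"
      using eventually_bound_le_powr[OF A \<mu>01(3) c p(2,1)] q2 eventually_ge_at_top[of 6]
    proof eventually_elim
      case (elim n)
      define q where "q = real n powr (1 / 40)"
      define K where "K = nat \<lfloor>real n powr (A + 4)\<rfloor>"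
      have n: "real n \<ge> 6" using elim(3) by simp
      have y: "2 \<le> real n powr (A + 4)"
      proof -
        have "real n powr 1 \<le> real n powr (A + 4)" using n A by (intro powr_mono) auto
        then show ?thesis using n by simp
      qed
      have K: "real K \<le> real n powr (A + 4)" "real n powr (A + 4) - 1 < real K"
        using y by (auto simp: K_def)
      have K0: "K > 0" using K(2) y by (cases K) auto
      have q40: "q ^ 40 = real n"
        using n by (simp add: q_def powr_power)
      have Khalf: "real n powr (A + 4) / 2 \<le> real K" using K y by simp
      have bd: "5 * exp (- (\<mu> / 2) * q\<^sup>2) \<le> q ^ 8 / real K"
        "real n * (norm_term n q + real (K + 1) * (small_scale_term n q c p + large_scale_term n q (real K))
         + 4 * (5 * q ^ 4 / real K + exp (- (\<mu> / 2) * q\<^sup>2))) \<le> real n powr (- A)"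
        using elim(1)[rule_format, OF Khalf K(1)] unfolding Let_def q_def[symmetric] by blast+
      \<comment> \<open>one power of \<open>n \<ge> 6\<close> pays for the constant 3 and for \<open>K + 1 \<le> 2 n powr (A + 4)\<close>\<close>
      have "real n ^ 4 * (3 * real (K + 1)) \<le> real n powr (A + 9)"
      proof -
        have "3 * real (K + 1) \<le> 6 * real n powr (A + 4)" using K y by simp
        also have "\<dots> \<le> real n * real n powr (A + 4)" using n by (intro mult_right_mono) auto
        also have "\<dots> = real n powr (A + 5)" using n powr_add[of "real n" 1 "A + 4"] by (simp add: add.commute)
        finally have "real n ^ 4 * (3 * real (K + 1)) \<le> real n ^ 4 * real n powr (A + 5)"
          by (intro mult_left_mono) auto
        also have "\<dots> = real n powr (A + 9)" using n powr_add[of "real n" 4 "A + 5"] by (simp add: add.commute)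
        finally show ?thesis .
      qed
      then have "{M. condition_number M \<ge> ereal (real n powr (A + 9))}
          \<subseteq> {M. condition_number M \<ge> ereal (real n ^ 4 * (3 * real (K + 1)))}"
        by (auto intro: order_trans[rotated])
      then have "measure_pmf.prob (random_mat n \<mu>) {M. condition_number M \<ge> ereal (real n powr (A + 9))}
        \<le> measure_pmf.prob (random_mat n \<mu>) {M. condition_number M \<ge> ereal (real n ^ 4 * (3 * real (K + 1)))}"
        by (intro measure_pmf.finite_measure_mono) auto
      also note prob_large_condition_number_le[OF \<mu>01(1,2) elim(2)[folded q_def] q40 K0 bd(1) c p(2) crude]
      also note bd(2)
      finally show ?case .
    qed
    then show ?thesis by (simp add: eventually_sequentially)
  qed
  then show "\<exists>B>0. \<forall>\<mu>. 0 < \<mu> \<and> \<mu> \<le> 1 \<longrightarrow> (\<exists>N. \<forall>n\<ge>N.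
      measure_pmf.prob (random_mat n \<mu>) {M. condition_number M \<ge> ereal (real n powr B)} \<le> real n powr (- A))"
    using A by (intro exI[of _ "A + 9"]) auto
qed

end
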